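(* Let $0\le\beta<1$ and $\gamma>0$ be real numbers, and let $\{t_n\}_{n=1}^{\infty}$ be a sequence of real numbers with $t_1\ge 1$ satisfying $$\frac{t_{n+1}}{t_n}\ge 1+\frac{\gamma}{n^{\beta}}\qquad\text{for all } n\in\mathbb{N}.$$ Then the set $$\left\{\alpha\in[0,1]:\ \exists\,\varkappa>0\ \ \forall n\in\mathbb{N}\ \ \|t_n\alpha\|>\frac{\varkappa}{n^{\beta}\log(n+1)}\right\}$$ is uncountable; moreover, its Hausdorff dimension is equal to $1$.
   Context: $\mathbb{N}=\{1,2,3,\dots\}$. For real $x$, $\|x\|$ denotes the distance from $x$ to the nearest integer. *)

theory Defs
  imports "HOL-Analysis.Analysis"
begin

definition nearest_int_dist :: "real \<Rightarrow> real" where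
  "nearest_int_dist x = \<bar>x - of_int (round x)\<bar>"

lemma nearest_int_dist_le: "nearest_int_dist x \<le> \<bar>x - of_int m\<bar>"
  unfolding nearest_int_dist_def by (rule round_diff_minimal)

(* The cost (diam U)^s of a covering set. Since 0 powr 0 = 0 in HOL, the case s = 0 is
   separated, so that the 0-dimensional measure counts points; the empty set costs nothing. *)
definition hausdorff_cost :: "real \<Rightarrow> 'a::metric_space set \<Rightarrow> ennreal" where
  "hausdorff_cost s U =
     (if U = {} then 0 else if s = 0 then 1 else ennreal (diameter U powr s))"

(* Boundedness is required explicitly because diameter is real-valued and carries no
   information on unbounded sets. Finite covers are included, by padding with empty sets. *)
definition hausdorff_premeasure :: "real \<Rightarrow> real \<Rightarrow> 'a::metric_space set \<Rightarrow> ennreal" where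
  "hausdorff_premeasure s \<delta> A =
     (INF U \<in> {U :: nat \<Rightarrow> 'a set. A \<subseteq> (\<Union>i. U i) \<and> (\<forall>i. bounded (U i) \<and> diameter (U i) \<le> \<delta>)}.
        \<Sum>i. hausdorff_cost s (U i))"

definition hausdorff_measure :: "real \<Rightarrow> 'a::metric_space set \<Rightarrow> ennreal" where
  "hausdorff_measure s A = (SUP \<delta> \<in> {0<..}. hausdorff_premeasure s \<delta> A)"

(* Extended-valued: the infimum of the empty set is infinity. *)
definition hausdorff_dim :: "'a::metric_space set \<Rightarrow> ennreal" where
  "hausdorff_dim A = Inf {ennreal s | s. 0 \<le> s \<and> hausdorff_measure s A = 0}"

end

theory Submission
  imports Defs "HOL-Real_Asymp.Real_Asymp"
begin

text \<open>The argument of Peres and Schlag, with coverings treated as additional obstacles. Let \<open>E n\<close> be the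
  set where \<open>t n * x\<close> is within \<open>\<delta> n\<close> of an integer, and delete from \<open>{0..<1}\<close>, one after the other,
  the hulls of \<open>E 1, E 2, \<dots>\<close> in dyadic grids of mesh about \<open>\<delta> n / t n\<close>. The set left after step \<open>m\<close> is
  a union of grid intervals, and \<open>E n\<close> is equidistributed in each of these as soon as \<open>t n \<ge> 2 * t m / \<delta> m\<close>,
  which holds for \<open>n - m\<close> of order \<open>n powr \<beta> * ln n\<close>. Over such a stretch the measure drops by at
  most a factor \<open>2\<close> when \<open>\<kappa>\<close> is small, so step \<open>n\<close> costs only a proportion \<open>O(\<delta> n)\<close> of what is left.

  If the surviving set had \<open>s\<close>-dimensional measure \<open>0\<close> for some \<open>s < 1\<close>, then by compactness it would have
  a finite cover by balls with small sum of \<open>s\<close>-th powers of radii. The balls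
  whose radius lies between the meshes \<open>n\<close> and \<open>n - 1\<close> can be deleted along with \<open>E n\<close>: their
  total length is at most a small multiple of \<open>t (n - 1) powr (s - 1)\<close>, whereas the measure left at that stage is at least
  \<open>t (n - 1) powr (- o(1))\<close>. Hence some point survives that the cover misses, a contradiction.\<close>

subsection \<open>Dyadic sets\<close>

lemma nearest_int_dist_le_iff: "nearest_int_dist x \<le> c \<longleftrightarrow> (\<exists>j::int. \<bar>x - of_int j\<bar> \<le> c)"
  by (metis nearest_int_dist_def nearest_int_dist_le order_trans)

lemma closed_nearest_int_dist_ge: "closed {x. c \<le> nearest_int_dist (T * x)}"
proof -
  have "c \<le> nearest_int_dist y \<longleftrightarrow> (\<forall>j::int. c \<le> \<bar>y - of_int j\<bar>)" for y
    by (metis nearest_int_dist_def nearest_int_dist_le order_trans)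
  then have "{x. c \<le> nearest_int_dist (T * x)} = (\<Inter>j::int. {x. c \<le> \<bar>T * x - of_int j\<bar>})"
    by auto
  also have "closed \<dots>"
    by (intro closed_INT ballI closed_Collect_le continuous_intros)
  finally show ?thesis .
qed

definition cell :: "nat \<Rightarrow> int \<Rightarrow> real set" where
  "cell l a = {of_int a / 2 ^ l ..< (of_int a + 1) / 2 ^ l}"

lemma mem_cell_iff: "x \<in> cell l a \<longleftrightarrow> \<lfloor>2 ^ l * x\<rfloor> = a"
  by (auto simp: cell_def floor_eq_iff field_simps)

lemma measure_cell: "measure lborel (cell l a) = 1 / 2 ^ l"
  by (simp add: cell_def field_simps)

text \<open>Unions of cells of level \<open>l\<close>, encoded as invariance under moving within a
  cell, so that refinement and set difference become purely logical.\<close>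

definition dyadic :: "nat \<Rightarrow> real set \<Rightarrow> bool" where
  "dyadic l G \<longleftrightarrow> (\<forall>x y. \<lfloor>2 ^ l * x\<rfloor> = \<lfloor>2 ^ l * y\<rfloor> \<longrightarrow> x \<in> G \<longrightarrow> y \<in> G)"

text \<open>The coarse floor is a function of the fine one, namely its integer quotient by
  \<open>2 ^ (k - l)\<close>.\<close>

lemma dyadic_mono:
  assumes "dyadic l G" "l \<le> k"
  shows "dyadic k G"
proof -
  have "\<lfloor>2 ^ l * x\<rfloor> = \<lfloor>2 ^ k * x\<rfloor> div 2 ^ (k - l)" for x :: real
  proof -
    have "2 ^ l * x = (2 ^ k * x) / real_of_int (2 ^ (k - l))"
      using assms(2) by (simp only: of_int_power of_int_numeral) (simp add: power_diff)
    then show ?thesis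
      by (metis floor_divide_real_eq_div zero_le_numeral zero_le_power)
  qed
  then show ?thesis
    using assms(1) unfolding dyadic_def by (metis (no_types, lifting))
qed

lemma dyadic_Diff: "dyadic l G \<Longrightarrow> dyadic l H \<Longrightarrow> dyadic l (G - H)"
  unfolding dyadic_def by (metis DiffD1 DiffD2 DiffI)

lemma dyadic_unit_interval: "dyadic 0 {0..<1}"
proof -
  have "x \<in> {0..<1} \<longleftrightarrow> \<lfloor>x\<rfloor> = 0" for x :: real
    by (auto simp: floor_eq_iff)
  then show ?thesis unfolding dyadic_def by simp
qed

lemma dyadic_eq_UN_cells:
  assumes "dyadic l G"
  shows "G = (\<Union>a\<in>{a. cell l a \<subseteq> G}. cell l a)"
proof
  show "G \<subseteq> (\<Union>a\<in>{a. cell l a \<subseteq> G}. cell l a)"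
  proof
    fix x assume "x \<in> G"
    then have "cell l \<lfloor>2 ^ l * x\<rfloor> \<subseteq> G"
      using assms unfolding dyadic_def subset_iff mem_cell_iff by metis
    then show "x \<in> (\<Union>a\<in>{a. cell l a \<subseteq> G}. cell l a)"
      using mem_cell_iff by blast
  qed
qed auto

lemma dyadic_borel: "dyadic l G \<Longrightarrow> G \<in> sets borel"
  by (subst dyadic_eq_UN_cells, assumption, intro sets.countable_UN') (auto simp: cell_def)

text \<open>The smallest union of cells of level \<open>l\<close> containing \<open>B\<close>.
  Deleting it instead of \<open>B\<close> keeps the remainder dyadic.\<close>

definition dyadic_hull :: "nat \<Rightarrow> real set \<Rightarrow> real set" where
  "dyadic_hull l B = {y. \<exists>x\<in>B. \<lfloor>2 ^ l * x\<rfloor> = \<lfloor>2 ^ l * y\<rfloor>}"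

lemma dyadic_dyadic_hull: "dyadic l (dyadic_hull l B)"
  unfolding dyadic_def dyadic_hull_def by auto

lemma subset_dyadic_hull: "B \<subseteq> dyadic_hull l B"
  unfolding dyadic_hull_def by auto

lemma dyadic_hull_Un: "dyadic_hull l (A \<union> B) = dyadic_hull l A \<union> dyadic_hull l B"
  unfolding dyadic_hull_def by auto

lemma dyadic_hull_UN: "dyadic_hull l (\<Union>i\<in>I. B i) = (\<Union>i\<in>I. dyadic_hull l (B i))"
  unfolding dyadic_hull_def by auto

lemma dyadic_hullE:
  assumes "y \<in> dyadic_hull l B"
  obtains x where "x \<in> B" "\<bar>x - y\<bar> < 1 / 2 ^ l"
proof -
  obtain x where x: "x \<in> B" "\<lfloor>2 ^ l * x\<rfloor> = \<lfloor>2 ^ l * y\<rfloor>"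
    using assms unfolding dyadic_hull_def by auto
  then have "\<bar>2 ^ l * x - 2 ^ l * y\<bar> < 1"
    by linarith
  then have "2 ^ l * \<bar>x - y\<bar> < 1"
    by (simp add: abs_mult flip: right_diff_distrib)
  then show ?thesis
    using that x(1) by (simp add: field_simps)
qed

lemma fmeasurable_Icc: "{a..b} \<in> fmeasurable lborel" for a b :: real
  using fmeasurable_cbox[of a b] by simp

text \<open>Reduces equidistribution to single cells: \<open>G\<close> is a disjoint union of cells,
  finitely many because it lies in the unit interval.\<close>

lemma measure_dyadic_Int_le:
  assumes G: "dyadic l G" "G \<subseteq> {0..<1}" and E: "E \<in> sets borel"
    and le: "\<And>a. measure lborel (cell l a \<inter> E) \<le> c * measure lborel (cell l a)"
  shows "measure lborel (G \<inter> E) \<le> c * measure lborel G"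
proof -
  define S where "S = {a. cell l a \<subseteq> G}"
  have GS: "G = (\<Union>a\<in>S. cell l a)"
    unfolding S_def using G(1) by (rule dyadic_eq_UN_cells)
  have "S \<subseteq> {0..2 ^ l}"
  proof
    fix a assume "a \<in> S"
    then have "real_of_int a / 2 ^ l \<in> G"
      unfolding GS by (intro UN_I[of a]) (auto simp: mem_cell_iff)
    then have "0 \<le> real_of_int a / 2 ^ l" "real_of_int a / 2 ^ l < 1"
      using G(2) by auto
    then have "0 * 2 ^ l \<le> real_of_int a" "real_of_int a < 1 * 2 ^ l"
      by (simp_all only: pos_le_divide_eq pos_divide_less_eq zero_less_power zero_less_numeral)
    then have "0 \<le> a" "a < 2 ^ l"
      by simp_all
    then show "a \<in> {0..2 ^ l}"
      by auto
  qed
  then have fin: "finite S"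
    using finite_subset by blast
  have disj: "disjoint_family_on (cell l) S"
    by (auto simp: disjoint_family_on_def mem_cell_iff set_eq_iff)
  have fm: "cell l a \<in> fmeasurable lborel" for a
    unfolding cell_def by (rule fmeasurableI2[OF fmeasurable_Icc[of "of_int a / 2 ^ l" "(of_int a + 1) / 2 ^ l"]]) auto
  have "G \<inter> E = (\<Union>a\<in>S. cell l a \<inter> E)"
    using GS by blast
  then have "measure lborel (G \<inter> E) = measure lborel (\<Union>a\<in>S. cell l a \<inter> E)"
    by (rule arg_cong)
  also have "\<dots> \<le> (\<Sum>a\<in>S. measure lborel (cell l a \<inter> E))"
    using E fin by (intro measure_UNION_le) (auto simp: cell_def)
  also have "\<dots> \<le> (\<Sum>a\<in>S. c * measure lborel (cell l a))"
    by (intro sum_mono le)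
  also have "\<dots> = c * measure lborel G"
  proof -
    have "measure lborel G = (\<Sum>a\<in>S. measure lborel (cell l a))"
      unfolding GS using fin disj fmeasurableD[OF fm] fmeasurableD2[OF fm]
      by (intro measure_finite_Union) auto
    then show ?thesis by (simp add: sum_distrib_left)
  qed
  finally show ?thesis .
qed

lemma nearest_int_dist_le_borel: "{x. nearest_int_dist (T * x) \<le> c} \<in> sets borel"
proof -
  have "{x. nearest_int_dist (T * x) \<le> c} = (\<Union>j::int. {x. \<bar>T * x - of_int j\<bar> \<le> c})"
    by (auto simp: nearest_int_dist_le_iff)
  also have "\<dots> \<in> sets borel"
    by (intro sets.countable_UN'') (auto intro!: borel_closed closed_Collect_le continuous_intros)
  finally show ?thesis .
qed

text \<open>Multiplication by \<open>T\<close> stretches the cell to length at least 1, so at most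
  \<open>3 * T / 2 ^ l\<close> integers matter, and each accounts for length at most
  \<open>2 * c / T\<close>.\<close>

lemma measure_cell_nearest_int_dist:
  assumes T: "2 ^ l \<le> T" and c: "0 \<le> c" "c \<le> 1/2"
  shows "measure lborel (cell l a \<inter> {x. nearest_int_dist (T * x) \<le> c}) \<le> 6 * c * measure lborel (cell l a)"
proof -
  have T0: "T > 0"
    using T by (smt (verit) zero_less_power)
  define u v where "u = T * (of_int a / 2 ^ l) - c" and "v = T * ((of_int a + 1) / 2 ^ l) + c"
  define J where "J = {\<lceil>u\<rceil>..\<lfloor>v\<rfloor>}"
  have sub: "cell l a \<inter> {x. nearest_int_dist (T * x) \<le> c} \<subseteq> (\<Union>j\<in>J. {(of_int j - c) / T..(of_int j + c) / T})"
  proof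
    fix x assume x: "x \<in> cell l a \<inter> {x. nearest_int_dist (T * x) \<le> c}"
    then obtain j :: int where j: "\<bar>T * x - of_int j\<bar> \<le> c"
      by (auto simp: nearest_int_dist_le_iff)
    have "T * (of_int a / 2 ^ l) \<le> T * x" "T * x \<le> T * ((of_int a + 1) / 2 ^ l)"
      using x T0 by (intro mult_left_mono; simp add: cell_def)+
    then have "j \<in> J"
      using j unfolding J_def u_def v_def by (auto simp: ceiling_le_iff le_floor_iff)
    moreover have "x \<in> {(of_int j - c) / T..(of_int j + c) / T}"
      using j T0 by (auto simp: field_simps abs_le_iff)
    ultimately show "x \<in> (\<Union>j\<in>J. {(of_int j - c) / T..(of_int j + c) / T})" by blast
  qed
  have uv: "v - u = T / 2 ^ l + 2 * c"
    unfolding u_def v_def by (simp add: field_simps)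
  have "1 \<le> T / 2 ^ l"
    using T by (simp add: field_simps)
  \<comment> \<open>An interval of length \<open>v - u\<close> contains at most
    \<open>v - u + 1\<close> integers, here at most \<open>T / 2 ^ l + 2\<close>.\<close>
  then have "real (card J) \<le> 3 * (T / 2 ^ l)"
    using uv c unfolding J_def card_atLeastAtMost_int by linarith
  have "measure lborel (cell l a \<inter> {x. nearest_int_dist (T * x) \<le> c})
      \<le> measure lborel (\<Union>j\<in>J. {(of_int j - c) / T..(of_int j + c) / T})"
    using sub nearest_int_dist_le_borel[of T c]
    by (intro measure_mono_fmeasurable fmeasurable.finite_UN) (auto simp: J_def cell_def fmeasurable_Icc)
  also have "\<dots> \<le> (\<Sum>j\<in>J. measure lborel {(of_int j - c) / T..(of_int j + c) / T})"
    by (intro measure_UNION_le) (auto simp: J_def)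
  also have "\<dots> = (\<Sum>j\<in>J. 2 * c / T)"
    using T0 c by (intro sum.cong) (auto simp: field_simps)
  also have "\<dots> = real (card J) * (2 * c / T)"
    by simp
  also have "\<dots> \<le> 3 * (T / 2 ^ l) * (2 * c / T)"
    using \<open>real (card J) \<le> _\<close> T0 c by (intro mult_right_mono) auto
  also have "\<dots> = 6 * c * measure lborel (cell l a)"
    using T0 by (simp add: measure_cell)
  finally show ?thesis .
qed

subsection \<open>Deleting the forbidden sets and a finite cover\<close>

text \<open>The factor \<open>48\<close> is \<open>12 * 2 + 4 * 6\<close>: relative to \<open>G (m n)\<close>, which has at most twice the measure
  of \<open>G (n - 1)\<close>, the hull of the \<open>n\<close>-th forbidden set takes a proportion \<open>12 * \<delta> n\<close>, and the hulls
  of the balls of the \<open>n\<close>-th size class take \<open>4\<close> times the bound in \<open>cover\<close>.\<close>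

lemma exists_avoiding_point:
  fixes T \<delta> :: "nat \<Rightarrow> real" and L m :: "nat \<Rightarrow> nat" and c d :: "'i \<Rightarrow> real"
  assumes \<delta>: "\<And>n. n \<ge> 1 \<Longrightarrow> 0 < \<delta> n \<and> \<delta> n \<le> 1/96"
    and T0: "\<And>n. n \<ge> 1 \<Longrightarrow> 0 < T n"
    and L0: "L 0 = 0" and "mono L"
    and fine: "\<And>n. n \<ge> 1 \<Longrightarrow> T n \<le> \<delta> n * 2 ^ L n"
    and m: "\<And>n. n \<ge> 1 \<Longrightarrow> m n < n" "\<And>n. n \<ge> 1 \<Longrightarrow> 2 ^ L (m n) \<le> T n"
    and half: "\<And>n. n \<ge> 1 \<Longrightarrow> 1/2 \<le> (\<Prod>k\<in>{m n<..<n}. 1 - 48 * \<delta> k)"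
    and I: "finite I" "\<And>i. i \<in> I \<Longrightarrow> d i < 1" "\<And>i. i \<in> I \<Longrightarrow> \<exists>n. 1 / 2 ^ L n \<le> d i"
    and cover: "\<And>n. n \<ge> 1 \<Longrightarrow> (\<Sum>i | i \<in> I \<and> 1 / 2 ^ L n \<le> d i \<and> d i < 1 / 2 ^ L (n - 1). d i)
                  \<le> 6 * \<delta> n * (\<Prod>k\<in>{0<..<n}. 1 - 48 * \<delta> k)"
  shows "\<exists>x\<in>{0..1}. (\<forall>n\<ge>1. \<delta> n \<le> nearest_int_dist (T n * x)) \<and> (\<forall>i\<in>I. d i \<le> \<bar>x - c i\<bar>)"
proof -
  define W where "W n = {i \<in> I. 1 / 2 ^ L n \<le> d i \<and> d i < 1 / 2 ^ L (n - 1)}" for n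
  define E where "E n = {x. nearest_int_dist (T n * x) \<le> \<delta> n}" for n
  define B where "B n = (\<Union>i\<in>W n. ball (c i) (d i))" for n
  define G where "G = rec_nat {0..<1} (\<lambda>n G. G - dyadic_hull (L (Suc n)) (E (Suc n) \<union> B (Suc n)))"
  have G0: "G 0 = {0..<1}"
    and GS: "G (Suc n) = G n - dyadic_hull (L (Suc n)) (E (Suc n) \<union> B (Suc n))" for n
    unfolding G_def by simp_all
  have dyG: "dyadic (L n) (G n)" for n
  proof (induction n)
    case 0
    then show ?case using L0 dyadic_unit_interval by (simp add: G0)
  next
    case (Suc n)
    then show ?case
      unfolding GS using \<open>mono L\<close>
      by (intro dyadic_Diff dyadic_dyadic_hull) (auto intro: dyadic_mono dest: incseq_SucD)
  qed
  have anti: "antimono G"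
    by (intro antimonoI) (metis GS Diff_subset lift_Suc_antimono_le)
  have Gsub: "G n \<subseteq> {0..<1}" for n
    using antimonoD[OF anti, of 0 n] G0 by simp
  have Gb: "G n \<in> sets borel" for n
    using dyG dyadic_borel by blast
  have Gfm: "G n \<in> fmeasurable lborel" for n
    by (rule fmeasurableI2[of "{0..<1}"]) (use Gsub Gb in \<open>auto intro: fmeasurableI\<close>)
  let ?\<mu> = "measure lborel"
  \<comment> \<open>By \<open>fine\<close>, a move within a cell changes \<open>T n * x\<close> by
    at most \<open>\<delta> n\<close>, so the hull at worst doubles the forbidden radius.\<close>
  have Ehull: "?\<mu> (G k \<inter> dyadic_hull (L n) (E n)) \<le> 12 * \<delta> n * ?\<mu> (G k)"
    if n: "n \<ge> 1" and k: "2 ^ L k \<le> T n" for n k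
  proof -
    let ?E = "{x. nearest_int_dist (T n * x) \<le> 2 * \<delta> n}"
    have "dyadic_hull (L n) (E n) \<subseteq> ?E"
    proof
      fix y assume "y \<in> dyadic_hull (L n) (E n)"
      then obtain x where x: "x \<in> E n" "\<bar>x - y\<bar> < 1 / 2 ^ L n"
        by (rule dyadic_hullE)
      then obtain j :: int where j: "\<bar>T n * x - of_int j\<bar> \<le> \<delta> n"
        by (auto simp: E_def nearest_int_dist_le_iff)
      have "\<bar>T n * x - T n * y\<bar> = T n * \<bar>x - y\<bar>"
        using T0[OF n] by (simp add: abs_mult flip: right_diff_distrib)
      also have "\<dots> \<le> (\<delta> n * 2 ^ L n) * (1 / 2 ^ L n)"
        using x(2) fine[OF n] T0[OF n] \<delta>[OF n] by (intro mult_mono) auto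
      finally have "\<bar>T n * y - of_int j\<bar> \<le> 2 * \<delta> n"
        using j by simp
      then show "y \<in> ?E"
        by (auto simp: nearest_int_dist_le_iff)
    qed
    then have "?\<mu> (G k \<inter> dyadic_hull (L n) (E n)) \<le> ?\<mu> (G k \<inter> ?E)"
      using Gfm Gb nearest_int_dist_le_borel dyadic_borel[OF dyadic_dyadic_hull]
      by (intro measure_mono_fmeasurable fmeasurable_Int_fmeasurable sets.Int) auto
    also have "\<dots> \<le> 6 * (2 * \<delta> n) * ?\<mu> (G k)"
      using \<delta>[OF n] k
      by (intro measure_dyadic_Int_le[OF dyG Gsub nearest_int_dist_le_borel] measure_cell_nearest_int_dist) auto
    finally show ?thesis by simp
  qed
  \<comment> \<open>The mesh is at most \<open>d i\<close> for \<open>i\<close> in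
    \<open>W n\<close>, so the hull at worst doubles the radius of the ball and fits in an interval
    of length \<open>4 * d i\<close>.\<close>
  have Bhull: "?\<mu> (G k \<inter> dyadic_hull (L n) (B n)) \<le> 4 * (\<Sum>i\<in>W n. d i)" for n k
  proof -
    have finW: "finite (W n)"
      using I(1) by (simp add: W_def)
    have pos: "0 < d i" if "i \<in> W n" for i
      using that unfolding W_def by (smt (verit) mem_Collect_eq divide_pos_pos zero_less_power)
    have "dyadic_hull (L n) (ball (c i) (d i)) \<subseteq> {c i - 2 * d i..c i + 2 * d i}" if "i \<in> W n" for i
    proof
      fix y assume "y \<in> dyadic_hull (L n) (ball (c i) (d i))"
      then obtain x where "x \<in> ball (c i) (d i)" "\<bar>x - y\<bar> < 1 / 2 ^ L n"
        by (rule dyadic_hullE)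
      then show "y \<in> {c i - 2 * d i..c i + 2 * d i}"
        using that by (auto simp: W_def dist_real_def)
    qed
    then have "G k \<inter> dyadic_hull (L n) (B n) \<subseteq> (\<Union>i\<in>W n. {c i - 2 * d i..c i + 2 * d i})"
      unfolding B_def dyadic_hull_UN by blast
    then have "?\<mu> (G k \<inter> dyadic_hull (L n) (B n)) \<le> ?\<mu> (\<Union>i\<in>W n. {c i - 2 * d i..c i + 2 * d i})"
      using finW Gb dyadic_borel[OF dyadic_dyadic_hull] fmeasurable_Icc
      by (intro measure_mono_fmeasurable fmeasurable.finite_UN) auto
    also have "\<dots> \<le> (\<Sum>i\<in>W n. ?\<mu> {c i - 2 * d i..c i + 2 * d i})"
      using finW by (intro measure_UNION_le) auto
    also have "\<dots> = (\<Sum>i\<in>W n. 4 * d i)"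
      using pos by (intro sum.cong) (auto dest!: pos)
    finally show ?thesis
      by (simp add: sum_distrib_left)
  qed
  let ?q = "\<lambda>k. 1 - 48 * \<delta> k"
  have q0: "0 < ?q k" if "k \<ge> 1" for k
    using \<delta>[OF that] by simp
  have main: "?q n * ?\<mu> (G (n - 1)) \<le> ?\<mu> (G n)" if "n \<ge> 1" for n
    using that
  proof (induction n rule: less_induct)
    case (less n)
    \<comment> \<open>The induction hypothesis chained from \<open>a\<close> to \<open>b\<close>. It
      is used twice: from \<open>m n\<close>, where \<open>half\<close> limits the loss to a factor
      2, and from 0, where the measure is 1 and \<open>cover\<close> turns into a bound relative to
      \<open>G b\<close>.\<close>
    have step: "(\<Prod>k\<in>{a<..<Suc b}. ?q k) * ?\<mu> (G a) \<le> ?\<mu> (G b)" if "a \<le> b" "b < n" for a b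
      using that
    proof (induction b rule: dec_induct)
      case base
      have "{a<..<Suc a} = {}"
        by auto
      then show ?case
        by simp
    next
      case (step b)
      have "{a<..<Suc (Suc b)} = insert (Suc b) {a<..<Suc b}"
        using step by auto
      then have "(\<Prod>k\<in>{a<..<Suc (Suc b)}. ?q k) * ?\<mu> (G a) = ?q (Suc b) * ((\<Prod>k\<in>{a<..<Suc b}. ?q k) * ?\<mu> (G a))"
        by simp
      also have "\<dots> \<le> ?q (Suc b) * ?\<mu> (G b)"
        using step q0[of "Suc b"] by (intro mult_left_mono) auto
      also have "\<dots> \<le> ?\<mu> (G (Suc b))"
        using less.IH[of "Suc b"] step by simp
      finally show ?case .
    qed
    obtain b where b: "n = Suc b"
      using less.prems by (cases n) auto
    have mn: "m n \<le> b"
      using m(1)[OF less.prems] b by simp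
    have "1/2 * ?\<mu> (G (m n)) \<le> (\<Prod>k\<in>{m n<..<n}. ?q k) * ?\<mu> (G (m n))"
      by (intro mult_right_mono half less.prems) simp
    also have "\<dots> \<le> ?\<mu> (G b)"
      using step[OF mn] b by simp
    finally have half': "?\<mu> (G (m n)) \<le> 2 * ?\<mu> (G b)" by simp
    have "(\<Prod>k\<in>{0<..<n}. ?q k) \<le> ?\<mu> (G b)"
      using step[of 0 b] b by (simp add: G0)
    then have "6 * \<delta> n * (\<Prod>k\<in>{0<..<n}. ?q k) \<le> 6 * \<delta> n * ?\<mu> (G b)"
      using \<delta>[OF less.prems] by (intro mult_left_mono) auto
    then have cov: "(\<Sum>i\<in>W n. d i) \<le> 6 * \<delta> n * ?\<mu> (G b)"
      using cover[OF less.prems] unfolding W_def by linarith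
    let ?D = "dyadic_hull (L n) (E n)" and ?F = "dyadic_hull (L n) (B n)"
    have DF: "G b \<inter> ?D \<in> fmeasurable lborel" "G b \<inter> ?F \<in> fmeasurable lborel"
      "G (m n) \<inter> ?D \<in> fmeasurable lborel"
      using Gfm dyadic_borel[OF dyadic_dyadic_hull] by (auto intro!: fmeasurable_Int_fmeasurable)
    have "G b \<subseteq> G n \<union> (G b \<inter> ?D \<union> G b \<inter> ?F)"
      by (auto simp: b GS dyadic_hull_Un)
    then have "?\<mu> (G b) \<le> ?\<mu> (G n \<union> (G b \<inter> ?D \<union> G b \<inter> ?F))"
      by (rule measure_mono_fmeasurable) (simp add: Gb, intro fmeasurable.Un DF Gfm)
    also have "\<dots> \<le> ?\<mu> (G n) + ?\<mu> (G b \<inter> ?D \<union> G b \<inter> ?F)"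
      by (intro measure_Un_le sets.Un fmeasurableD DF Gfm)
    also have "?\<mu> (G b \<inter> ?D \<union> G b \<inter> ?F) \<le> ?\<mu> (G b \<inter> ?D) + ?\<mu> (G b \<inter> ?F)"
      by (intro measure_Un_le fmeasurableD DF)
    \<comment> \<open>The cells of \<open>G b\<close> may be too short for \<open>E n\<close> to be
      equidistributed in them, so the estimate is made in the larger set \<open>G (m n)\<close>,
      whose cells are long enough.\<close>
    also have "?\<mu> (G b \<inter> ?D) \<le> ?\<mu> (G (m n) \<inter> ?D)"
      using DF antimonoD[OF anti mn] by (intro measure_mono_fmeasurable) auto
    also have "\<dots> \<le> 12 * \<delta> n * ?\<mu> (G (m n))"
      using less.prems m by (intro Ehull) auto
    also have "\<dots> \<le> 12 * \<delta> n * (2 * ?\<mu> (G b))"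
      using half' \<delta>[OF less.prems] by (intro mult_left_mono) auto
    also have "?\<mu> (G b \<inter> ?F) \<le> 4 * (6 * \<delta> n * ?\<mu> (G b))"
      using Bhull[of b n] cov by linarith
    finally show ?case
      by (simp add: b algebra_simps)
  qed
  have Gpos: "0 < ?\<mu> (G n)" for n
  proof (induction n)
    case (Suc n)
    then have "0 < ?q (Suc n) * ?\<mu> (G n)"
      using q0[of "Suc n"] by (intro mult_pos_pos) auto
    then show ?case
      using main[of "Suc n"] by simp
  qed (simp add: G0)
  \<comment> \<open>\<open>G n\<close> consists of half-open cells and need not be closed.
    \<open>K n\<close> records the conditions of the first \<open>n\<close> steps as closed ones, so
    the nested intersection is nonempty.\<close>
  define K where "K n = {0..1} \<inter> (\<Inter>k\<in>{1..n}. {x. \<delta> k \<le> nearest_int_dist (T k * x)} \<inter> (\<Inter>i\<in>W k. {x. d i \<le> \<bar>x - c i\<bar>}))" for n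
  have "closed (\<Inter>k\<in>{1..n}. {x. \<delta> k \<le> nearest_int_dist (T k * x)} \<inter> (\<Inter>i\<in>W k. {x. d i \<le> \<bar>x - c i\<bar>}))" for n
    by (intro closed_INT ballI closed_Int closed_nearest_int_dist_ge closed_Collect_le continuous_intros)
  then have comp: "compact (K n)" for n
    unfolding K_def by (intro compact_Int_closed) auto
  have GK: "G n \<subseteq> K n" for n
  proof (induction n)
    case 0
    then show ?case by (auto simp: G0 K_def)
  next
    case (Suc n)
    have "K (Suc n) = K n \<inter> ({x. \<delta> (Suc n) \<le> nearest_int_dist (T (Suc n) * x)} \<inter> (\<Inter>i\<in>W (Suc n). {x. d i \<le> \<bar>x - c i\<bar>}))"
      unfolding K_def by (auto simp: atLeastAtMostSuc_conv)
    moreover have "x \<notin> E (Suc n) \<union> B (Suc n)" if "x \<in> G (Suc n)" for x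
      using that subset_dyadic_hull unfolding GS by blast
    ultimately show ?case
      using Suc unfolding GS E_def B_def by (fastforce simp: dist_real_def abs_minus_commute)
  qed
  have "K n \<noteq> {}" for n
    using GK[of n] Gpos[of n] by auto
  moreover have "K j \<subseteq> K i" if "i \<le> j" for i j
    unfolding K_def using that by auto
  ultimately have "(\<Inter>n. K n) \<noteq> {}"
    by (intro compact_nest comp)
  then obtain x where x: "\<And>n. x \<in> K n"
    by auto
  have "\<delta> n \<le> nearest_int_dist (T n * x)" if "n \<ge> 1" for n
    using x[of n] that unfolding K_def by auto
  moreover have "d i \<le> \<bar>x - c i\<bar>" if i: "i \<in> I" for i
  proof -
    \<comment> \<open>The first grid with mesh at most \<open>d i\<close> determines the size class
      of ball \<open>i\<close>. It is not grid 0, whose mesh is 1.\<close>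
    define n where "n = (LEAST n. 1 / 2 ^ L n \<le> d i)"
    have n: "1 / 2 ^ L n \<le> d i"
      unfolding n_def using I(3)[OF i] by (rule LeastI_ex)
    have "n \<ge> 1"
      using n I(2)[OF i] L0 by (cases n) auto
    then have "d i < 1 / 2 ^ L (n - 1)"
      using not_less_Least[of "n - 1" "\<lambda>n. 1 / 2 ^ L n \<le> d i"] unfolding n_def by simp
    then have "i \<in> W n"
      using n i by (simp add: W_def)
    then show ?thesis
      using x[of n] \<open>n \<ge> 1\<close> unfolding K_def by auto
  qed
  moreover have "x \<in> {0..1}"
    using x[of 0] by (simp add: K_def)
  ultimately show ?thesis by blast
qed

subsection \<open>Growth estimates\<close>

lemma tendsto_powr_ln_over_self:
  fixes \<beta> :: real
  assumes "\<beta> < 1"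
  shows "((\<lambda>x. x powr \<beta> * ln x / x) \<longlongrightarrow> 0) at_top"
proof -
  define b where "b = 1 - \<beta>"
  have "b > 0" using assms by (simp add: b_def)
  then have "((\<lambda>x. ln x / x powr b) \<longlongrightarrow> 0) at_top"
    by real_asymp
  moreover have "eventually (\<lambda>x. ln x / x powr b = x powr \<beta> * ln x / x) at_top"
    using eventually_gt_at_top[of 0]
    by eventually_elim (simp add: b_def powr_diff)
  ultimately show ?thesis
    by (rule Lim_transform_eventually)
qed

lemma eventually_powr_ln_le_half:
  fixes \<beta> K :: real
  assumes "\<beta> < 1"
  shows "eventually (\<lambda>x. K * (x powr \<beta> * ln x) + 1 \<le> x / 2) at_top"
proof -
  have "((\<lambda>x. K * (x powr \<beta> * ln x / x) + 1 / x) \<longlongrightarrow> K * 0 + 0) at_top"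
    by (intro tendsto_intros tendsto_powr_ln_over_self assms) real_asymp
  then have "eventually (\<lambda>x. K * (x powr \<beta> * ln x / x) + 1 / x < 1/2) at_top"
    by (rule order_tendstoD) simp
  then show ?thesis
    using eventually_gt_at_top[of 0] by eventually_elim (simp add: field_simps)
qed

lemma ln_add1_ge:
  fixes x :: real
  assumes "0 \<le> x"
  shows "x / (1 + x) \<le> ln (1 + x)"
proof -
  have "ln (1 / (1 + x)) \<le> 1 / (1 + x) - 1"
    using assms by (intro ln_le_minus_one) auto
  then show ?thesis
    using assms by (simp add: ln_div field_simps)
qed

text \<open>Follows from \<open>ln (1 + z) \<ge> z / (1 + z)\<close>, the denominator being at most
  \<open>1 + \<gamma>\<close>. It is applied with \<open>y = 1 / n powr \<beta>\<close>.\<close>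

lemma ln_one_plus_mult_ge:
  fixes \<gamma> y :: real
  assumes "0 < \<gamma>" "0 \<le> y" "y \<le> 1"
  shows "\<gamma> / (1 + \<gamma>) * y \<le> ln (1 + \<gamma> * y)"
proof -
  have "\<gamma> * y / (1 + \<gamma>) \<le> \<gamma> * y / (1 + \<gamma> * y)"
    using assms by (intro divide_left_mono) (auto simp: mult_le_cancel_left1 intro!: mult_pos_pos add_pos_nonneg)
  also have "\<dots> \<le> ln (1 + \<gamma> * y)"
    using assms by (intro ln_add1_ge) auto
  finally show ?thesis
    by simp
qed

text \<open>A linear lower bound that also serves exponents below 1; the relevant exponent is
  \<open>1 - s\<close>.\<close>

lemma one_plus_powr_ge:
  fixes a \<gamma> y :: real
  assumes "0 \<le> a" "0 < \<gamma>" "0 \<le> y" "y \<le> 1"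
  shows "1 + a * \<gamma> / (1 + \<gamma>) * y \<le> (1 + \<gamma> * y) powr a"
proof -
  have "1 + a * \<gamma> / (1 + \<gamma>) * y \<le> 1 + a * ln (1 + \<gamma> * y)"
    using mult_left_mono[OF ln_one_plus_mult_ge[of \<gamma> y], of a] assms by simp
  also have "\<dots> \<le> exp (a * ln (1 + \<gamma> * y))"
    by (rule exp_ge_add_one_self)
  also have "\<dots> = (1 + \<gamma> * y) powr a"
    using assms add_pos_nonneg[of 1 "\<gamma> * y"] by (simp add: powr_def)
  finally show ?thesis .
qed

text \<open>Each of the two factors grows by at most \<open>1 + 1 / x\<close>. For the logarithm
  this uses \<open>ln x \<ge> 1\<close>.\<close>

lemma powr_ln_Suc_le:
  fixes \<beta> x :: real
  assumes "0 \<le> \<beta>" "\<beta> \<le> 1" "3 \<le> x"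
  shows "(x + 1) powr \<beta> * ln (x + 1) \<le> (1 + 3 / x) * (x powr \<beta> * ln x)"
proof -
  have l: "1 \<le> ln x"
    using assms exp_le by (subst ln_ge_iff) auto
  have e: "x + 1 = x * (1 + 1 / x)"
    using assms by (simp add: field_simps)
  have "(1 + 1 / x) powr \<beta> \<le> (1 + 1 / x) powr 1"
    using assms by (intro powr_mono) auto
  then have "(1 + 1 / x) powr \<beta> \<le> 1 + 1 / x"
    using assms by (subst (asm) powr_one) (simp_all add: add_nonneg_nonneg)
  then have 1: "(x + 1) powr \<beta> \<le> x powr \<beta> * (1 + 1 / x)"
    using assms unfolding e by (subst powr_mult) (auto intro!: mult_left_mono)
  have "ln (x + 1) = ln x + ln (1 + 1 / x)"
    using assms unfolding e by (subst ln_mult) (simp_all add: add_pos_pos add_pos_pos[THEN less_imp_neq, THEN not_sym])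
  also have "\<dots> \<le> ln x + 1 / x"
    using assms by (intro add_left_mono ln_add_one_self_le_self) auto
  also have "\<dots> \<le> ln x * (1 + 1 / x)"
    using assms l by (simp add: field_simps)
  finally have 2: "ln (x + 1) \<le> ln x * (1 + 1 / x)" .
  have "(x + 1) powr \<beta> * ln (x + 1) \<le> (x powr \<beta> * (1 + 1 / x)) * (ln x * (1 + 1 / x))"
    using assms l by (intro mult_mono 1 2) auto
  also have "\<dots> = (1 + 1 / x)^2 * (x powr \<beta> * ln x)"
    by (simp add: power2_eq_square)
  also have "\<dots> \<le> (1 + 3 / x) * (x powr \<beta> * ln x)"
  proof (intro mult_right_mono)
    have "1 / x * (1 / x) \<le> 1 / x * 1"
      using assms by (intro mult_left_mono) auto
    then show "(1 + 1 / x)^2 \<le> 1 + 3 / x"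
      by (simp add: power2_eq_square algebra_simps)
  qed (use l in auto)
  finally show ?thesis .
qed

text \<open>Because \<open>1 / x powr \<beta>\<close> dominates both \<open>1 / x\<close> and \<open>1 / (x powr \<beta> * ln x)\<close>.\<close>

lemma eventually_growth_dominates:
  fixes \<beta> \<gamma> a C :: real
  assumes "0 \<le> \<beta>" "\<beta> < 1" "0 < a" "0 < \<gamma>" "0 \<le> C"
  shows "eventually (\<lambda>x. (x + 1) powr \<beta> * ln (x + 1)
           \<le> (1 + \<gamma> / x powr \<beta>) powr a * (1 - C / (x powr \<beta> * ln x)) * (x powr \<beta> * ln x)) at_top"
proof -
  define c where "c = a * \<gamma> / (1 + \<gamma>)"
  have c: "c > 0" using assms by (simp add: c_def)
  define b where "b = 1 - \<beta>"
  have "b > 0" using assms by (simp add: b_def)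
  then have "filterlim (\<lambda>x::real. x powr b) at_top at_top"
    by real_asymp
  \<comment> \<open>The gain \<open>c * y\<close>, with \<open>y = 1 / x powr \<beta>\<close>, is
    shared equally: this threshold lets one half absorb \<open>3 / x\<close>, and the next one lets
    the other half absorb the loss with constant \<open>C\<close>.\<close>
  then have ev1: "eventually (\<lambda>x::real. x powr b \<ge> 6 / c) at_top"
    by (simp add: filterlim_at_top)
  have ev2: "eventually (\<lambda>x::real. ln x \<ge> 2 * C * (1 + c) / c) at_top"
    using ln_at_top by (simp add: filterlim_at_top)
  show ?thesis
    using ev1 ev2 eventually_ge_at_top[of 3]
  proof eventually_elim
    case (elim x)
    define y where "y = 1 / x powr \<beta>"
    have y: "0 < y" "y \<le> 1"
      using elim assms ge_one_powr_ge_zero[of x \<beta>] by (auto simp: y_def)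
    have l: "1 \<le> ln x"
      using elim exp_le by (subst ln_ge_iff) auto
    have "3 / x \<le> c / 2 * y"
    proof -
      have "x powr \<beta> * (6 / c) \<le> x powr \<beta> * x powr b"
        using elim by (intro mult_left_mono) auto
      also have "\<dots> = x"
        using elim by (simp add: b_def flip: powr_add)
      finally show ?thesis
        using elim c by (simp add: y_def field_simps)
    qed
    moreover have "C * y / ln x * (1 + c * y) \<le> c / 2 * y"
    proof -
      have "2 * C * (1 + c) \<le> c * ln x"
        using elim c by (simp add: field_simps)
      then have "C * (1 + c) / ln x \<le> c / 2"
        using l by (simp add: field_simps)
      have "C * y / ln x * (1 + c * y) \<le> C * y / ln x * (1 + c)"
        using y c assms l by (intro mult_left_mono) (auto simp: mult_le_cancel_left1)
      also have "\<dots> = y * (C * (1 + c) / ln x)"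
        by simp
      also have "\<dots> \<le> y * (c / 2)"
        using y \<open>C * (1 + c) / ln x \<le> c / 2\<close> by (intro mult_left_mono) auto
      finally show ?thesis by (simp add: mult.commute)
    qed
    moreover have "(1 + c * y) * (1 - C * y / ln x) = 1 + c * y - C * y / ln x * (1 + c * y)"
      by algebra
    ultimately have "1 + 3 / x \<le> (1 + c * y) * (1 - C * y / ln x)"
      by linarith
    have Cy: "C * y / ln x = C / (x powr \<beta> * ln x)"
      by (simp add: y_def)
    \<comment> \<open>The sign is read off from the product, which is at least
      \<open>1 + 3 / x\<close>. It permits the multiplication by this factor at the end.\<close>
    have nn: "0 \<le> 1 - C / (x powr \<beta> * ln x)"
    proof -
      have "0 < 1 + c * y" using c y by (simp add: add_pos_pos)
      moreover have "0 < (1 + c * y) * (1 - C * y / ln x)"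
        using \<open>1 + 3 / x \<le> _\<close> elim by (smt (verit) divide_pos_pos)
      ultimately show ?thesis
        unfolding Cy[symmetric] by (smt (verit) zero_less_mult_pos)
    qed
    have "(x + 1) powr \<beta> * ln (x + 1) \<le> (1 + 3 / x) * (x powr \<beta> * ln x)"
      using assms elim by (intro powr_ln_Suc_le) auto
    also have "\<dots> \<le> (1 + c * y) * (1 - C / (x powr \<beta> * ln x)) * (x powr \<beta> * ln x)"
      using \<open>1 + 3 / x \<le> _\<close> l unfolding Cy by (intro mult_right_mono) auto
    also have "\<dots> \<le> (1 + \<gamma> / x powr \<beta>) powr a * (1 - C / (x powr \<beta> * ln x)) * (x powr \<beta> * ln x)"
      using one_plus_powr_ge[of a \<gamma> y] assms y l nn
      by (intro mult_right_mono) (auto simp: c_def y_def)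
    finally show ?case .
  qed
qed

lemma two_power_ceiling_log:
  fixes y :: real
  assumes "1 \<le> y"
  shows "y \<le> 2 ^ nat \<lceil>log 2 y\<rceil>" "2 ^ nat \<lceil>log 2 y\<rceil> \<le> 2 * y"
proof -
  have "0 \<le> log 2 y"
    using assms by simp
  then have e: "(2::real) ^ nat \<lceil>log 2 y\<rceil> = 2 powr real_of_int \<lceil>log 2 y\<rceil>"
    by (simp flip: powr_realpow)
  have "y = 2 powr log 2 y"
    using assms by simp
  also have "\<dots> \<le> 2 powr real_of_int \<lceil>log 2 y\<rceil>"
    by (intro powr_mono) auto
  finally show "y \<le> 2 ^ nat \<lceil>log 2 y\<rceil>"
    unfolding e .
  have "2 powr real_of_int \<lceil>log 2 y\<rceil> \<le> 2 powr (log 2 y + 1)"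
    by (intro powr_mono) linarith+
  also have "\<dots> = 2 * y"
    using assms by (simp add: powr_add)
  finally show "2 ^ nat \<lceil>log 2 y\<rceil> \<le> 2 * y"
    unfolding e .
qed

lemma eventually_nondecreasing_bounded_below:
  fixes u :: "nat \<Rightarrow> real"
  assumes pos: "\<And>n. 0 < u n" and ev: "eventually (\<lambda>n. u n \<le> u (Suc n)) sequentially"
  shows "\<exists>e>0. \<forall>n. e \<le> u n"
proof -
  obtain n0 where n0: "\<And>n. n \<ge> n0 \<Longrightarrow> u n \<le> u (Suc n)"
    using ev by (auto simp: eventually_sequentially)
  have le: "u n0 \<le> u n" if "n \<ge> n0" for n
    using that by (induction n rule: dec_induct) (auto intro: order_trans n0)
  let ?e = "Min (u ` {..n0})"
  have "?e \<le> u n" for n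
  proof (cases "n \<le> n0")
    case False
    have "?e \<le> u n0" by simp
    then show ?thesis
      using le[of n] False by linarith
  qed simp
  moreover have "0 < ?e"
    using pos by simp
  ultimately show ?thesis by blast
qed

text \<open>The convention \<open>T 0 = 1\<close> makes level \<open>0\<close>, the whole unit interval, obey the same bounds as the
  later levels.\<close>

locale sparse_sequence =
  fixes \<beta> \<gamma> :: real and T :: "nat \<Rightarrow> real"
  assumes \<beta>: "0 \<le> \<beta>" "\<beta> < 1" and \<gamma>: "0 < \<gamma>"
    and T_0: "T 0 = 1" and T_1: "1 \<le> T 1"
    and growth: "\<And>n. n \<ge> 1 \<Longrightarrow> (1 + \<gamma> / real n powr \<beta>) * T n \<le> T (Suc n)"
begin

lemma T_ge_1: "1 \<le> T n" and T_Suc: "T n \<le> T (Suc n)"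
proof -
  have "1 \<le> T n \<and> T n \<le> T (Suc n)"
  proof (induction n)
    case 0
    then show ?case using T_0 T_1 by simp
  next
    case (Suc n)
    have "1 * T (Suc n) \<le> (1 + \<gamma> / real (Suc n) powr \<beta>) * T (Suc n)"
      using Suc \<gamma> by (intro mult_right_mono) auto
    also have "\<dots> \<le> T (Suc (Suc n))"
      by (intro growth) simp
    finally show ?case using Suc by simp
  qed
  then show "1 \<le> T n" "T n \<le> T (Suc n)" by auto
qed

text \<open>The guaranteed growth factors decrease with the index, so each of them is at least the
  one at \<open>n\<close>.\<close>

lemma T_ratio:
  assumes "1 \<le> i" "i \<le> n"
  shows "(1 + \<gamma> / real n powr \<beta>) ^ (n - i) * T i \<le> T n"
proof -
  have "(1 + \<gamma> / real n powr \<beta>) ^ (j - i) * T i \<le> T j" if "i \<le> j" "j \<le> n" for j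
    using that
  proof (induction j rule: dec_induct)
    case (step j)
    have "(1 + \<gamma> / real n powr \<beta>) ^ (Suc j - i) * T i
        = (1 + \<gamma> / real n powr \<beta>) * ((1 + \<gamma> / real n powr \<beta>) ^ (j - i) * T i)"
      using step by (simp add: Suc_diff_le)
    also have "\<dots> \<le> (1 + \<gamma> / real j powr \<beta>) * T j"
    proof (rule mult_mono)
      show "1 + \<gamma> / real n powr \<beta> \<le> 1 + \<gamma> / real j powr \<beta>"
        using assms step \<gamma> \<beta> by (intro add_left_mono divide_left_mono powr_mono2) auto
    qed (use step \<gamma> T_ge_1[of i] in auto)
    also have "\<dots> \<le> T (Suc j)"
      using step assms by (intro growth) auto
    finally show ?case .
  qed simp
  then show ?thesis
    using assms by simp
qed

text \<open>The order of \<open>1 / \<delta> n\<close>, and also of the number of steps in which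
  \<open>T\<close> gains a fixed power of \<open>n\<close>.\<close>

definition weight :: "real \<Rightarrow> real" where
  "weight x = x powr \<beta> * ln x"

lemma ln_ge_1: "3 \<le> x \<Longrightarrow> 1 \<le> ln x" for x :: real
  using exp_le by (subst ln_ge_iff) auto

lemma weight_ge_ln: "3 \<le> x \<Longrightarrow> ln x \<le> weight x"
  using mult_right_mono[of 1 "x powr \<beta>" "ln x"] ge_one_powr_ge_zero[of x \<beta>] \<beta> by (simp add: weight_def)

lemma weight_ge_1: "3 \<le> x \<Longrightarrow> 1 \<le> weight x"
  using weight_ge_ln[of x] ln_ge_1[of x] by simp

lemma weight_mono: "3 \<le> x \<Longrightarrow> x \<le> y \<Longrightarrow> weight x \<le> weight y"
  unfolding weight_def using \<beta> by (intro mult_mono powr_mono2) auto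

text \<open>Crude, but with \<open>2 / \<kappa> \<le> shift\<close> it keeps
  \<open>2 / \<delta> i\<close> below the cube gained over a lag.\<close>

lemma weight_le_square: "3 \<le> x \<Longrightarrow> weight x \<le> x ^ 2"
proof -
  assume x: "3 \<le> x"
  have "x powr \<beta> \<le> x powr 1"
    using x \<beta> by (intro powr_mono) auto
  then have "x powr \<beta> * ln x \<le> x * x"
    using x ln_bound[of x] by (intro mult_mono) auto
  then show ?thesis by (simp add: weight_def power2_eq_square)
qed

text \<open>Halving the argument costs each factor at most one half:
  \<open>2 powr \<beta> \<le> 2\<close>, and \<open>ln (x / 2) \<ge> ln x / 2\<close> as soon as
  \<open>x \<ge> 4\<close>.\<close>

lemma weight_half: "6 \<le> x \<Longrightarrow> x / 2 \<le> y \<Longrightarrow> weight x / 4 \<le> weight y"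
proof -
  assume x: "6 \<le> x" "x / 2 \<le> y"
  have "x powr \<beta> / 2 \<le> x powr \<beta> / 2 powr \<beta>"
    using \<beta> powr_mono[of \<beta> 1 2] x by (intro divide_left_mono) auto
  also have "\<dots> = (x / 2) powr \<beta>"
    using x by (simp add: powr_divide)
  also have "\<dots> \<le> y powr \<beta>"
    using x \<beta> by (intro powr_mono2) auto
  finally have 1: "x powr \<beta> / 2 \<le> y powr \<beta>" .
  have "2 * ln 2 = ln (2 ^ 2 :: real)"
    by (subst ln_realpow) auto
  also have "\<dots> \<le> ln x"
    using x by (subst ln_le_cancel_iff) auto
  finally have "ln x / 2 \<le> ln (x / 2)"
    using x by (simp add: ln_div)
  also have "\<dots> \<le> ln y"
    using x by simp
  finally have 2: "ln x / 2 \<le> ln y" .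
  have "(x powr \<beta> / 2) * (ln x / 2) \<le> y powr \<beta> * ln y"
    using x by (intro mult_mono 1 2) auto
  then show ?thesis
    by (simp add: weight_def)
qed

text \<open>\<open>lag_factor\<close> gives \<open>T n / T (n - lag n) \<ge> (n + shift) ^ 3\<close>, and \<open>\<kappa>\<close> solves
  \<open>4 * 48 * \<kappa> * lag_factor = 1/2\<close>.\<close>

definition lag_factor where "lag_factor = 3 * (1 + \<gamma>) / \<gamma>"

definition \<kappa> where "\<kappa> = 1 / (384 * lag_factor)"

lemma lag_factor_ge: "3 \<le> lag_factor"
  using \<gamma> by (simp add: lag_factor_def field_simps)

lemma \<kappa>_bounds: "0 < \<kappa>" "\<kappa> \<le> 1/96"
  using lag_factor_ge by (auto simp: \<kappa>_def field_simps)

text \<open>Replacing \<open>n\<close> by \<open>n + shift\<close> in the radii makes the lag at most half of the argument, so that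
  \<open>weight\<close> varies by at most a factor \<open>4\<close> over a lag; it also absorbs the constant \<open>2 / \<kappa>\<close> in
  \<open>two_power_level_le_T\<close>.\<close>

definition shift :: nat where
  "shift = (SOME N. 6 \<le> real N \<and> 2 / \<kappa> \<le> real N \<and> (\<forall>x\<ge>real N. lag_factor * weight x + 1 \<le> x / 2))"

lemma shift: "6 \<le> real shift" "2 / \<kappa> \<le> real shift" "\<And>x. x \<ge> real shift \<Longrightarrow> lag_factor * weight x + 1 \<le> x / 2"
proof -
  have "eventually (\<lambda>x. lag_factor * weight x + 1 \<le> x / 2) at_top"
    unfolding weight_def using \<beta>(2) by (rule eventually_powr_ln_le_half)
  then obtain x0 where x0: "\<And>x. x \<ge> x0 \<Longrightarrow> lag_factor * weight x + 1 \<le> x / 2"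
    by (auto simp: eventually_at_top_linorder)
  obtain N :: nat where "max 6 (max (2 / \<kappa>) x0) \<le> real N"
    using real_arch_simple by blast
  then have "6 \<le> real N \<and> 2 / \<kappa> \<le> real N \<and> (\<forall>x\<ge>real N. lag_factor * weight x + 1 \<le> x / 2)"
    using x0 by auto
  then have "6 \<le> real shift \<and> 2 / \<kappa> \<le> real shift \<and> (\<forall>x\<ge>real shift. lag_factor * weight x + 1 \<le> x / 2)"
    unfolding shift_def by (rule someI)
  then show "6 \<le> real shift" "2 / \<kappa> \<le> real shift" "\<And>x. x \<ge> real shift \<Longrightarrow> lag_factor * weight x + 1 \<le> x / 2"
    by auto
qed

section \<open>Radii, grids and lags\<close>

definition \<delta> :: "nat \<Rightarrow> real" where
  "\<delta> n = \<kappa> / weight (real (n + shift))"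

text \<open>The coarsest dyadic grid of mesh at most \<open>\<delta> n / T n\<close>. Index 0 is set
  apart because the deletion starts from the whole unit interval.\<close>

definition level :: "nat \<Rightarrow> nat" where
  "level n = (if n = 0 then 0 else nat \<lceil>log 2 (T n / \<delta> n)\<rceil>)"

text \<open>How far back to go from step \<open>n\<close> to find cells long enough for
  equidistribution of the \<open>n\<close>-th forbidden set.\<close>

definition lag :: "nat \<Rightarrow> nat" where
  "lag n = nat \<lceil>lag_factor * weight (real (n + shift))\<rceil>"

lemma arg_ge: "6 \<le> real (n + shift)"
  using shift(1) by simp

lemma weight_arg_ge_1: "1 \<le> weight (real (n + shift))"
  using arg_ge[of n] by (intro weight_ge_1) linarith

lemma \<delta>_bounds: "0 < \<delta> n" "\<delta> n \<le> 1/96"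
proof -
  show "0 < \<delta> n"
    unfolding \<delta>_def using \<kappa>_bounds weight_arg_ge_1[of n] by (intro divide_pos_pos) auto
  have "\<delta> n \<le> \<kappa> / 1"
    unfolding \<delta>_def using \<kappa>_bounds weight_arg_ge_1[of n] by (intro divide_left_mono) auto
  then show "\<delta> n \<le> 1/96"
    using \<kappa>_bounds by simp
qed

lemma \<delta>_antimono: "i \<le> j \<Longrightarrow> \<delta> j \<le> \<delta> i"
  unfolding \<delta>_def using \<kappa>_bounds weight_arg_ge_1[of i] weight_arg_ge_1[of j] arg_ge[of i]
  by (intro divide_left_mono weight_mono mult_pos_pos) auto

lemma T_div_\<delta>_ge_1: "1 \<le> T n / \<delta> n"
  using T_ge_1[of n] \<delta>_bounds[of n] by (simp add: field_simps)

lemma level_bounds: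
  assumes "n \<ge> 1"
  shows "T n \<le> \<delta> n * 2 ^ level n" "2 ^ level n \<le> 2 * (T n / \<delta> n)"
proof -
  have "T n / \<delta> n \<le> 2 ^ level n" "2 ^ level n \<le> 2 * (T n / \<delta> n)"
    using two_power_ceiling_log[OF T_div_\<delta>_ge_1[of n]] assms by (auto simp: level_def)
  then show "T n \<le> \<delta> n * 2 ^ level n" "2 ^ level n \<le> 2 * (T n / \<delta> n)"
    using \<delta>_bounds[of n] by (auto simp: field_simps)
qed

lemma level_mono: "mono level"
proof (rule incseq_SucI)
  fix n
  have "log 2 (T n / \<delta> n) \<le> log 2 (T (Suc n) / \<delta> (Suc n))"
    using T_div_\<delta>_ge_1[of n] T_div_\<delta>_ge_1[of "Suc n"] T_Suc[of n] T_ge_1[of n] \<delta>_antimono[of n "Suc n"]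
      \<delta>_bounds[of "Suc n"]
    by (subst log_le_cancel_iff) (auto intro!: frac_le)
  then show "level n \<le> level (Suc n)"
    unfolding level_def by (cases "n = 0") (simp, simp only: nat.distinct if_False, intro nat_mono ceiling_mono)
qed

lemma T_le_two_power_level: "T n \<le> 2 ^ level n"
proof (cases "n = 0")
  case False
  then have "T n \<le> \<delta> n * 2 ^ level n"
    by (intro level_bounds) auto
  also have "\<dots> \<le> 1 * 2 ^ level n"
    using \<delta>_bounds[of n] by (intro mult_right_mono) auto
  finally show ?thesis by simp
qed (simp add: level_def T_0)

text \<open>The mesh is at most \<open>\<delta> n\<close>, which tends to 0; when
  \<open>\<beta> = 0\<close> this is due to the logarithm in \<open>weight\<close>.\<close>

lemma exists_fine_level:
  assumes "0 < (d::real)"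
  shows "\<exists>n. 1 / 2 ^ level n \<le> d"
proof -
  obtain n :: nat where n: "max 1 (exp (\<kappa> / d)) \<le> real n"
    using real_arch_simple by blast
  have "exp (\<kappa> / d) \<le> real (n + shift)"
    using n by simp
  then have "\<kappa> / d \<le> ln (real (n + shift))"
    using arg_ge[of n] by (subst ln_ge_iff) auto
  also have "\<dots> \<le> weight (real (n + shift))"
    using arg_ge[of n] by (intro weight_ge_ln) auto
  finally have "\<delta> n \<le> d"
    using assms weight_arg_ge_1[of n] by (simp add: \<delta>_def field_simps)
  have "1 \<le> \<delta> n * 2 ^ level n"
    using level_bounds(1)[of n] T_ge_1[of n] n by simp
  then have "1 / 2 ^ level n \<le> \<delta> n"
    by (simp add: field_simps)
  then show ?thesis
    using \<open>\<delta> n \<le> d\<close> order_trans by blast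
qed

lemma lag_bounds:
  "1 \<le> lag n" "lag_factor * weight (real (n + shift)) \<le> real (lag n)" "real (lag n) \<le> lag_factor * weight (real (n + shift)) + 1"
  "real (lag n) \<le> real (n + shift) / 2"
proof -
  have "1 * 1 \<le> lag_factor * weight (real (n + shift))"
    using lag_factor_ge weight_arg_ge_1[of n] by (intro mult_mono) auto
  then show "1 \<le> lag n" "lag_factor * weight (real (n + shift)) \<le> real (lag n)"
    and *: "real (lag n) \<le> lag_factor * weight (real (n + shift)) + 1"
    unfolding lag_def by linarith+
  show "real (lag n) \<le> real (n + shift) / 2"
    using shift(3)[of "real (n + shift)"] * by simp
qed

text \<open>Each step of the lag adds at least
  \<open>\<gamma> / (1 + \<gamma>) / n powr \<beta>\<close> to \<open>ln (T n)\<close>, so the lag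
  yields a factor \<open>(n + shift) ^ 3\<close>, which exceeds
  \<open>2 / \<delta> i\<close>.\<close>

lemma two_power_level_le_T:
  assumes n: "n \<ge> 1"
  shows "2 ^ level (n - lag n) \<le> T n"
proof (cases "n \<le> lag n")
  \<comment> \<open>Truncated subtraction gives index 0, where the grid has mesh 1.\<close>
  case True
  then show ?thesis
    using T_ge_1[of n] by (simp add: level_def)
next
  case False
  define i x where "i = n - lag n" and "x = real (n + shift)"
  have i: "1 \<le> i" "i \<le> n" "n - i = lag n"
    using False by (auto simp: i_def)
  have x: "6 \<le> x" "real shift \<le> x"
    using arg_ge[of n] by (auto simp: x_def)
  define y where "y = 1 / real n powr \<beta>"
  have y: "0 < y" "y \<le> 1"
    using n \<beta> ge_one_powr_ge_zero[of "real n" \<beta>] by (auto simp: y_def)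
  \<comment> \<open>The lag is computed at \<open>n + shift\<close> but the growth rate at
    \<open>n\<close>; the mismatch only helps.\<close>
  have "1 \<le> x powr \<beta> * y"
  proof -
    have "real n powr \<beta> \<le> x powr \<beta>"
      using \<beta> by (intro powr_mono2) (auto simp: x_def)
    then show ?thesis
      using n by (simp add: y_def)
  qed
  have "3 * ln x \<le> 3 * ln x * (x powr \<beta> * y)"
    using x \<open>1 \<le> x powr \<beta> * y\<close> by (simp add: mult_le_cancel_left1)
  also have "\<dots> = lag_factor * weight x * (\<gamma> / (1 + \<gamma>) * y)"
  proof -
    have "lag_factor * (\<gamma> / (1 + \<gamma>)) = 3"
      using \<gamma> add_pos_pos[of 1 \<gamma>] by (simp add: lag_factor_def divide_eq_eq)
    then have "lag_factor * weight x * (\<gamma> / (1 + \<gamma>) * y) = 3 * weight x * y"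
      by (metis mult.commute mult.left_commute)
    then show ?thesis
      by (simp add: weight_def)
  qed
  also have "\<dots> \<le> real (lag n) * ln (1 + \<gamma> * y)"
    using lag_bounds(2)[of n] y \<gamma> by (intro mult_mono ln_one_plus_mult_ge) (auto simp: x_def)
  also have "\<dots> = ln ((1 + \<gamma> * y) ^ lag n)"
    using y \<gamma> by (subst ln_realpow) (auto intro: add_pos_pos)
  finally have "ln (x ^ 3) \<le> ln ((1 + \<gamma> * y) ^ lag n)"
    using x by (subst ln_realpow) auto
  moreover have "0 < 1 + \<gamma> * y"
    using y \<gamma> by (auto intro: add_pos_pos)
  ultimately have cube: "x ^ 3 \<le> (1 + \<gamma> * y) ^ lag n"
    using x by (subst (asm) ln_le_cancel_iff) auto
  have "2 / \<delta> i = 2 / \<kappa> * weight (real (i + shift))"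
    by (simp add: \<delta>_def)
  also have "\<dots> \<le> x * x ^ 2"
  proof (rule mult_mono)
    have "weight (real (i + shift)) \<le> weight x"
      using i arg_ge[of i] by (intro weight_mono) (auto simp: x_def)
    also have "\<dots> \<le> x ^ 2"
      using x by (intro weight_le_square) auto
    finally show "weight (real (i + shift)) \<le> x ^ 2" .
  qed (use shift(2) x weight_arg_ge_1[of i] in auto)
  also have "\<dots> \<le> (1 + \<gamma> * y) ^ lag n"
    using cube by (simp add: power3_eq_cube power2_eq_square)
  finally have "2 / \<delta> i * T i \<le> (1 + \<gamma> * y) ^ lag n * T i"
    using T_ge_1[of i] by (intro mult_right_mono) auto
  also have "\<dots> \<le> T n"
    using T_ratio[OF i(1,2)] i(3) by (simp add: y_def)
  finally show ?thesis
    using level_bounds(2)[OF i(1)] by (simp add: i_def)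
qed

text \<open>The product is at least 1 minus the sum of the \<open>48 * \<delta> k\<close>. Within a
  lag \<open>weight\<close> varies by at most a factor 4, so the choice of \<open>\<kappa>\<close>
  keeps the sum below one half.\<close>

lemma half_le_prod:
  assumes n: "n \<ge> 1"
  shows "1/2 \<le> (\<Prod>k\<in>{n - lag n<..<n}. 1 - 48 * \<delta> k)"
proof -
  let ?F = "weight (real (n + shift))"
  have le: "48 * \<delta> k \<le> 192 * \<kappa> / ?F" if "k \<in> {n - lag n<..<n}" for k
  proof -
    have "real n \<le> real k + real (lag n)"
      using that by auto
    then have "real (n + shift) / 2 \<le> real (k + shift)"
      using lag_bounds(4)[of n] by (simp add: field_simps)
    then have "?F / 4 \<le> weight (real (k + shift))"
      using arg_ge[of n] by (intro weight_half)
    then have "\<kappa> / weight (real (k + shift)) \<le> \<kappa> / (?F / 4)"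
      using \<kappa>_bounds weight_arg_ge_1[of n] weight_arg_ge_1[of k] by (intro divide_left_mono mult_pos_pos) auto
    then show ?thesis
      by (simp add: \<delta>_def)
  qed
  have "(\<Sum>k\<in>{n - lag n<..<n}. 48 * \<delta> k) \<le> (\<Sum>k\<in>{n - lag n<..<n}. 192 * \<kappa> / ?F)"
    by (intro sum_mono le)
  also have "\<dots> = real (card {n - lag n<..<n}) * (192 * \<kappa> / ?F)"
    by simp
  also have "\<dots> \<le> (lag_factor * ?F) * (192 * \<kappa> / ?F)"
  proof (rule mult_right_mono)
    \<comment> \<open>The open interval has at most \<open>lag n - 1\<close> elements, which offsets
      the rounding up in \<open>lag\<close>.\<close>
    show "real (card {n - lag n<..<n}) \<le> lag_factor * ?F"
      using lag_bounds(1,3)[of n] n unfolding card_greaterThanLessThan by linarith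
  qed (use \<kappa>_bounds weight_arg_ge_1[of n] in auto)
  also have "\<dots> = 1/2"
    using weight_arg_ge_1[of n] lag_factor_ge by (simp add: \<kappa>_def)
  finally have "(\<Sum>k\<in>{n - lag n<..<n}. 48 * \<delta> k) \<le> 1/2" .
  moreover have "1 - (\<Sum>k\<in>{n - lag n<..<n}. 48 * \<delta> k) \<le> (\<Prod>k\<in>{n - lag n<..<n}. 1 - 48 * \<delta> k)"
  proof (rule Weierstrass_prod_ineq)
    show "48 * \<delta> k \<in> {0..1}" for k
      using \<delta>_bounds[of k] by simp
  qed
  ultimately show ?thesis by linarith
qed

text \<open>The bound is eventually nondecreasing in \<open>n\<close>: the growth of \<open>T n powr (1 - s)\<close> outweighs the
  decay of the measure estimate, whatever \<open>s < 1\<close> is.\<close>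

lemma cover_budget:
  assumes "s < 1"
  shows "\<exists>\<eta>>0. \<forall>n. \<eta> \<le> 6 * \<delta> (Suc n) * (\<Prod>k\<in>{0<..<Suc n}. 1 - 48 * \<delta> k) * T n powr (1 - s)"
proof -
  define u where "u n = 6 * \<delta> (Suc n) * (\<Prod>k\<in>{0<..<Suc n}. 1 - 48 * \<delta> k) * T n powr (1 - s)" for n
  have q: "0 < 1 - 48 * \<delta> k" for k
    using \<delta>_bounds[of k] by simp
  have P: "0 < (\<Prod>k\<in>{0<..<n}. 1 - 48 * \<delta> k)" for n
    by (intro prod_pos) (use q in auto)
  have "0 < u n" for n
    unfolding u_def using \<delta>_bounds[of "Suc n"] P[of "Suc n"] T_ge_1[of n] by (intro mult_pos_pos) auto
  moreover have "eventually (\<lambda>n. u n \<le> u (Suc n)) sequentially"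
  proof -
    have "filterlim (\<lambda>n. real (Suc n + shift)) at_top sequentially"
      by real_asymp
    \<comment> \<open>The constant \<open>48 * \<kappa>\<close> makes the loss factor exactly
      \<open>1 - 48 * \<delta> (Suc n)\<close>.\<close>
    from eventually_compose_filterlim[OF eventually_growth_dominates[OF \<beta>, of "1 - s" \<gamma> "48 * \<kappa>"] this]
    have "eventually (\<lambda>n. weight (real (Suc n + shift) + 1) \<le> (1 + \<gamma> / real (Suc n + shift) powr \<beta>) powr (1 - s) *
        (1 - 48 * \<kappa> / weight (real (Suc n + shift))) * weight (real (Suc n + shift))) sequentially"
      using assms \<gamma> \<kappa>_bounds by (simp add: weight_def)
    then show ?thesis
      using eventually_ge_at_top[of 1]
    proof eventually_elim
      case (elim n)
      define g where "g = (1 + \<gamma> / real (Suc n + shift) powr \<beta>) powr (1 - s)"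
      define F F' where "F = weight (real (Suc n + shift))" and "F' = weight (real (Suc (Suc n) + shift))"
      have F: "1 \<le> F" "1 \<le> F'"
        unfolding F_def F'_def by (intro weight_arg_ge_1)+
      have d: "\<delta> (Suc n) = \<kappa> / F" "\<delta> (Suc (Suc n)) = \<kappa> / F'"
        by (simp_all add: \<delta>_def F_def F'_def)
      have "F' \<le> g * (1 - 48 * \<delta> (Suc n)) * F"
        using elim by (simp add: g_def F_def F'_def \<delta>_def add_ac)
      \<comment> \<open>The dominance inequality multiplied by \<open>\<kappa> / (F * F')\<close>:
        \<open>g\<close> pays for the decrease of \<open>\<delta>\<close> and for the new factor of
        the product.\<close>
      then have d': "\<delta> (Suc n) \<le> \<delta> (Suc (Suc n)) * (g * (1 - 48 * \<delta> (Suc n)))"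
      proof -
        define w where "w = g * (1 - 48 * \<delta> (Suc n))"
        assume "F' \<le> g * (1 - 48 * \<delta> (Suc n)) * F"
        then have "\<kappa> * F' \<le> \<kappa> * (w * F)"
          using \<kappa>_bounds by (intro mult_left_mono) (auto simp: w_def)
        then have "\<kappa> / F \<le> \<kappa> / F' * w"
          using F by (simp add: field_simps)
        then show ?thesis
          unfolding w_def[symmetric] unfolding d .
      qed
      \<comment> \<open>The growth of \<open>T\<close> at \<open>n\<close> is at least the rate at
        \<open>Suc n + shift\<close> occurring in \<open>g\<close>.\<close>
      have "g * T n powr (1 - s) \<le> T (Suc n) powr (1 - s)"
      proof -
        have "(1 + \<gamma> / real (Suc n + shift) powr \<beta>) * T n \<le> (1 + \<gamma> / real n powr \<beta>) * T n"
          using elim \<gamma> \<beta> T_ge_1[of n]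
          by (intro mult_right_mono add_left_mono divide_left_mono powr_mono2 mult_pos_pos) auto
        also have "\<dots> \<le> T (Suc n)"
          using elim by (intro growth) auto
        finally have "((1 + \<gamma> / real (Suc n + shift) powr \<beta>) * T n) powr (1 - s) \<le> T (Suc n) powr (1 - s)"
          using assms \<gamma> T_ge_1[of n] by (intro powr_mono2) auto
        then show ?thesis
          using \<gamma> T_ge_1[of n] by (simp add: g_def powr_mult)
      qed
      define p where "p = (\<Prod>k\<in>{0<..<Suc n}. 1 - 48 * \<delta> k)"
      have "{0<..<Suc (Suc n)} = insert (Suc n) {0<..<Suc n}"
        by auto
      then have p': "(\<Prod>k\<in>{0<..<Suc (Suc n)}. 1 - 48 * \<delta> k) = (1 - 48 * \<delta> (Suc n)) * p"
        by (simp add: p_def)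
      have p0: "0 < p" unfolding p_def by (rule P)
      have "u n = \<delta> (Suc n) * (6 * p * T n powr (1 - s))"
        by (simp add: u_def p_def)
      also have "\<dots> \<le> \<delta> (Suc (Suc n)) * (g * (1 - 48 * \<delta> (Suc n))) * (6 * p * T n powr (1 - s))"
        using p0 by (intro mult_right_mono d') auto
      also have "\<dots> = 6 * \<delta> (Suc (Suc n)) * ((1 - 48 * \<delta> (Suc n)) * p) * (g * T n powr (1 - s))"
        by (simp only: mult_ac)
      also have "\<dots> \<le> 6 * \<delta> (Suc (Suc n)) * ((1 - 48 * \<delta> (Suc n)) * p) * T (Suc n) powr (1 - s)"
        using p0 q[of "Suc n"] \<delta>_bounds[of "Suc (Suc n)"] \<open>g * T n powr (1 - s) \<le> _\<close>
        by (intro mult_left_mono) auto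
      also have "\<dots> = u (Suc n)"
        by (simp add: u_def p')
      finally show ?case .
    qed
  qed
  ultimately show ?thesis
    unfolding u_def by (rule eventually_nondecreasing_bounded_below)
qed

text \<open>Writing \<open>d i\<close> as \<open>d i powr s * d i powr (1 - s)\<close> converts the
  bound on the \<open>s\<close>-sum into a bound on the total length of each size class, which
  \<open>cover_budget\<close> admits. One \<open>\<eta>\<close> serves all covers.\<close>

lemma not_covered:
  assumes "s < 1"
  shows "\<exists>\<eta>>0. \<forall>(I :: 'i set) c d. finite I \<longrightarrow> (\<forall>i\<in>I. 0 < d i \<and> d i < 1) \<longrightarrow> (\<Sum>i\<in>I. d i powr s) \<le> \<eta> \<longrightarrow>
    (\<exists>x\<in>{0..1}. (\<forall>n\<ge>1. \<delta> n \<le> nearest_int_dist (T n * x)) \<and> (\<forall>i\<in>I. d i \<le> \<bar>x - c i\<bar>))"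
proof -
  obtain \<eta> where \<eta>: "\<eta> > 0" "\<And>n. \<eta> \<le> 6 * \<delta> (Suc n) * (\<Prod>k\<in>{0<..<Suc n}. 1 - 48 * \<delta> k) * T n powr (1 - s)"
    using cover_budget[OF assms] by blast
  have "\<exists>x\<in>{0..1}. (\<forall>n\<ge>1. \<delta> n \<le> nearest_int_dist (T n * x)) \<and> (\<forall>i\<in>I. d i \<le> \<bar>x - c i\<bar>)"
    if I: "finite I" "\<And>i. i \<in> I \<Longrightarrow> 0 < d i \<and> d i < 1" and sum: "(\<Sum>i\<in>I. d i powr s) \<le> \<eta>"
    for I :: "'i set" and c d
  proof (rule exists_avoiding_point[where L = level and m = "\<lambda>n. n - lag n"])
    fix n :: nat assume "n \<ge> 1"
    then obtain j where j: "n = Suc j" by (cases n) auto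
    let ?P = "\<Prod>k\<in>{0<..<n}. 1 - 48 * \<delta> k"
    let ?W = "{i \<in> I. 1 / 2 ^ level n \<le> d i \<and> d i < 1 / 2 ^ level (n - 1)}"
    have Tj: "0 < T j" using T_ge_1[of j] by linarith
    have "d i \<le> d i powr s * (1 / T j) powr (1 - s)" if "i \<in> ?W" for i
    proof -
      \<comment> \<open>Radii of class \<open>n\<close> are controlled by the previous grid, hence
        the pairing of \<open>\<delta> (Suc n)\<close> with \<open>T n\<close> in
        \<open>cover_budget\<close>.\<close>
      have "d i \<le> 1 / 2 ^ level j"
        using that j by auto
      also have "\<dots> \<le> 1 / T j"
        using T_le_two_power_level[of j] Tj by (intro divide_left_mono) auto
      finally have "d i powr (1 - s) \<le> (1 / T j) powr (1 - s)"
        using that I(2) assms by (intro powr_mono2) (auto intro: less_imp_le)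
      then have "d i powr s * d i powr (1 - s) \<le> d i powr s * (1 / T j) powr (1 - s)"
        by (intro mult_left_mono) auto
      moreover have "d i powr s * d i powr (1 - s) = d i"
        using that I(2)[of i] by (simp flip: powr_add)
      ultimately show ?thesis by simp
    qed
    then have "(\<Sum>i\<in>?W. d i) \<le> (\<Sum>i\<in>?W. d i powr s * (1 / T j) powr (1 - s))"
      by (rule sum_mono)
    also have "\<dots> = (\<Sum>i\<in>?W. d i powr s) * (1 / T j) powr (1 - s)"
      by (simp add: sum_distrib_right)
    also have "\<dots> \<le> \<eta> * (1 / T j) powr (1 - s)"
    proof (rule mult_right_mono)
      have "(\<Sum>i\<in>?W. d i powr s) \<le> (\<Sum>i\<in>I. d i powr s)"
        using I(1) by (intro sum_mono2) auto
      then show "(\<Sum>i\<in>?W. d i powr s) \<le> \<eta>"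
        using sum by linarith
    qed simp
    also have "\<dots> \<le> 6 * \<delta> n * ?P * T j powr (1 - s) * (1 / T j) powr (1 - s)"
      using \<eta>(2)[of j] by (intro mult_right_mono) (auto simp: j)
    also have "\<dots> = 6 * \<delta> n * ?P"
      using Tj by (simp add: powr_divide)
    finally show "(\<Sum>i\<in>?W. d i) \<le> 6 * \<delta> n * ?P" .
    show "0 < T n" using T_ge_1[of n] by linarith
    show "0 < \<delta> n \<and> \<delta> n \<le> 1/96"
      using \<delta>_bounds by auto
    show "n - lag n < n"
      using lag_bounds(1)[of n] \<open>n \<ge> 1\<close> by linarith
    show "T n \<le> \<delta> n * 2 ^ level n" "2 ^ level (n - lag n) \<le> T n" "1/2 \<le> (\<Prod>k\<in>{n - lag n<..<n}. 1 - 48 * \<delta> k)"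
      using \<open>n \<ge> 1\<close> level_bounds(1) two_power_level_le_T half_le_prod by blast+
  next
    show "level 0 = 0"
      by (simp add: level_def)
    show "\<exists>n. 1 / 2 ^ level n \<le> d i" if "i \<in> I" for i
      using I(2)[OF that] by (intro exists_fine_level) simp
  qed (use level_mono I in auto)
  then show ?thesis
    using \<eta>(1) by (intro exI[of _ \<eta>]) blast
qed

section \<open>Comparison of the radii with the rate in the theorem\<close>

lemma weight_shift_le:
  assumes "n \<ge> 1"
  shows "weight (real (n + shift)) \<le> (real shift + 1) * real shift * (real n powr \<beta> * ln (real (n + 1)))"
proof -
  have "real (n + shift) \<le> (real shift + 1) * real n"
    using assms mult_left_mono[of 1 "real n" "real shift"] by (simp add: algebra_simps)
  then have "real (n + shift) powr \<beta> \<le> ((real shift + 1) * real n) powr \<beta>"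
    using \<beta> by (intro powr_mono2) auto
  also have "\<dots> = (real shift + 1) powr \<beta> * real n powr \<beta>"
    by (simp add: powr_mult)
  also have "\<dots> \<le> (real shift + 1) powr 1 * real n powr \<beta>"
    using \<beta> by (intro mult_right_mono powr_mono) auto
  finally have 1: "real (n + shift) powr \<beta> \<le> (real shift + 1) * real n powr \<beta>"
    by simp
  \<comment> \<open>Inside the logarithm the shift is turned into a power by Bernoulli's inequality,
    so it costs only a constant factor.\<close>
  have "real (n + shift) \<le> 1 + real shift * real n"
  proof -
    have "0 \<le> (real shift - 1) * (real n - 1)"
      using assms shift(1) by (intro mult_nonneg_nonneg) auto
    then show ?thesis by (simp add: algebra_simps)
  qed
  also have "\<dots> \<le> (1 + real n) ^ shift"
    using Bernoulli_inequality[of "real n" shift] by (simp add: mult.commute)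
  finally have "ln (real (n + shift)) \<le> ln ((1 + real n) ^ shift)"
    using assms by (subst ln_le_cancel_iff) auto
  also have "\<dots> = real shift * ln (real (n + 1))"
    by (subst ln_realpow) (auto simp: add.commute)
  finally have 2: "ln (real (n + shift)) \<le> real shift * ln (real (n + 1))" .
  have "weight (real (n + shift)) \<le> ((real shift + 1) * real n powr \<beta>) * (real shift * ln (real (n + 1)))"
    unfolding weight_def using arg_ge[of n] by (intro mult_mono 1 2) auto
  then show ?thesis by (simp add: mult_ac)
qed

lemma \<delta>_lower_bound:
  "\<exists>\<kappa>'>0. \<forall>n\<ge>1. \<kappa>' / (real n powr \<beta> * ln (real (n + 1))) < \<delta> n"
proof -
  define C where "C = (real shift + 1) * real shift"
  have C: "0 < C" using shift(1) by (simp add: C_def)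
  \<comment> \<open>Halving \<open>\<kappa> / C\<close> makes the inequality strict.\<close>
  have "\<kappa> / (2 * C) / (real n powr \<beta> * ln (real (n + 1))) < \<delta> n" if "n \<ge> 1" for n
  proof -
    let ?g = "real n powr \<beta> * ln (real (n + 1))"
    have g: "0 < ?g"
      using that by (intro mult_pos_pos) auto
    have "\<kappa> / (2 * C) / ?g < \<kappa> / (C * ?g)"
      using C g \<kappa>_bounds by (simp add: field_simps)
    also have "\<dots> \<le> \<delta> n"
      unfolding \<delta>_def using weight_shift_le[OF that] weight_arg_ge_1[of n] \<kappa>_bounds C g
      by (intro divide_left_mono mult_pos_pos) (use that in \<open>auto simp: C_def\<close>)
    finally show ?thesis .
  qed
  then show ?thesis
    using C \<kappa>_bounds by (intro exI[of _ "\<kappa> / (2 * C)"]) auto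
qed

end

subsection \<open>Hausdorff measure and dimension\<close>

lemma hausdorff_cost_pos: "0 < s \<Longrightarrow> hausdorff_cost s U = ennreal (diameter U powr s)"
  by (simp add: hausdorff_cost_def)

text \<open>The scale 1 is an arbitrary choice: small diameters will be forced by the small
  sum.\<close>

lemma exists_cheap_cover:
  assumes null: "hausdorff_measure s A = 0" and e: "0 < e"
  obtains U :: "nat \<Rightarrow> 'a::metric_space set"
  where "A \<subseteq> (\<Union>i. U i)" "\<And>i. bounded (U i)" "(\<Sum>i. hausdorff_cost s (U i)) < ennreal e"
proof -
  have "hausdorff_premeasure s 1 A \<le> hausdorff_measure s A"
    unfolding hausdorff_measure_def by (intro SUP_upper) auto
  then have "hausdorff_premeasure s 1 A < ennreal e"
    using null e by simp
  then show ?thesis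
    using that unfolding hausdorff_premeasure_def INF_less_iff by blast
qed

lemma compact_null_finite_ball_cover:
  fixes A X :: "'a::metric_space set"
  assumes null: "hausdorff_measure s A = 0" and s: "0 < s" and X: "compact X" "X \<subseteq> A" and e: "0 < e"
  obtains I :: "nat set" and c d
  where "finite I" "X \<subseteq> (\<Union>i\<in>I. ball (c i) (d i))" "\<And>i. i \<in> I \<Longrightarrow> 0 < d i" "(\<Sum>i\<in>I. d i powr s) \<le> e"
proof -
  \<comment> \<open>The factor \<open>2 powr s\<close> comes from doubling the radii, the other 2
    from adding two sums, one for the diameters and one for the \<open>\<epsilon> i\<close>.\<close>
  define e' where "e' = e / (2 * 2 powr s)"
  have e': "0 < e'" using e by (simp add: e'_def)
  obtain U where U: "A \<subseteq> (\<Union>i. U i)" "\<And>i. bounded (U i)" "(\<Sum>i. hausdorff_cost s (U i)) < ennreal e'"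
    using exists_cheap_cover[OF null e'] by blast
  \<comment> \<open>Positive radii even for sets of diameter 0, with \<open>s\<close>-th powers
    forming a geometric series of sum \<open>e'\<close>.\<close>
  define \<epsilon> where "\<epsilon> i = (e' * (1/2) ^ Suc i) powr (1 / s)" for i
  have \<epsilon>0: "0 < \<epsilon> i" for i
    using e' by (simp add: \<epsilon>_def)
  have \<epsilon>s: "\<epsilon> i powr s = e' * (1/2) ^ Suc i" for i
    using e' s by (simp add: \<epsilon>_def powr_powr)
  \<comment> \<open>For empty \<open>U i\<close> the centre is arbitrary and the inclusion in the
    ball is trivial.\<close>
  define c where "c i = (SOME x. x \<in> U i)" for i
  define d where "d i = 2 * max (diameter (U i)) (\<epsilon> i)" for i
  have d0: "0 < d i" for i
    using \<epsilon>0[of i] by (simp add: d_def)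
  have sub: "U i \<subseteq> ball (c i) (d i)" for i
  proof
    fix x assume x: "x \<in> U i"
    then have "c i \<in> U i"
      unfolding c_def by (rule someI)
    then have "dist (c i) x \<le> diameter (U i)"
      using x U(2) by (intro diameter_bounded_bound)
    then show "x \<in> ball (c i) (d i)"
      using \<epsilon>0[of i] by (auto simp: d_def)
  qed
  have "X \<subseteq> (\<Union>i\<in>UNIV. ball (c i) (d i))"
    using X(2) U(1) sub by blast
  then obtain I where I: "finite I" "X \<subseteq> (\<Union>i\<in>I. ball (c i) (d i))"
    using compactE_image[OF X(1), of UNIV "\<lambda>i. ball (c i) (d i)"] by auto
  have "ennreal (\<Sum>i\<in>I. diameter (U i) powr s) = (\<Sum>i\<in>I. hausdorff_cost s (U i))"
    using s by (simp add: hausdorff_cost_pos sum_ennreal)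
  also have "\<dots> \<le> (\<Sum>i. hausdorff_cost s (U i))"
    by (intro sum_le_suminf I) auto
  also have "\<dots> < ennreal e'" by (rule U)
  finally have 1: "(\<Sum>i\<in>I. diameter (U i) powr s) \<le> e'"
    by (simp add: ennreal_less_iff sum_nonneg)
  have "summable (\<lambda>i. (1/2::real) ^ Suc i)"
    using power_half_series by (rule sums_summable)
  then have "(\<Sum>i\<in>I. (1/2::real) ^ Suc i) \<le> (\<Sum>i. (1/2) ^ Suc i)"
    by (intro sum_le_suminf I) auto
  also have "\<dots> = 1"
    using power_half_series by (simp add: sums_iff)
  finally have "e' * (\<Sum>i\<in>I. (1/2::real) ^ Suc i) \<le> e' * 1"
    using e' by (intro mult_left_mono) auto
  then have 2: "(\<Sum>i\<in>I. \<epsilon> i powr s) \<le> e'"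
    by (simp only: \<epsilon>s sum_distrib_left mult_1_right)
  have "d i powr s \<le> 2 powr s * (diameter (U i) powr s + \<epsilon> i powr s)" for i
  proof -
    have "max (diameter (U i)) (\<epsilon> i) powr s \<le> diameter (U i) powr s + \<epsilon> i powr s"
      by (simp add: max_def)
    then show ?thesis
      using \<epsilon>0[of i] by (simp add: d_def powr_mult)
  qed
  then have "(\<Sum>i\<in>I. d i powr s) \<le> (\<Sum>i\<in>I. 2 powr s * (diameter (U i) powr s + \<epsilon> i powr s))"
    by (rule sum_mono)
  also have "\<dots> = 2 powr s * ((\<Sum>i\<in>I. diameter (U i) powr s) + (\<Sum>i\<in>I. \<epsilon> i powr s))"
    by (simp only: sum.distrib flip: sum_distrib_left)
  also have "\<dots> \<le> 2 powr s * (e' + e')"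
    by (intro mult_left_mono add_mono 1 2) auto
  also have "\<dots> = e"
    by (simp add: e'_def)
  finally show ?thesis
    using that[OF I] d0 by blast
qed

section \<open>Null sets and the dimension of subsets of the unit interval\<close>

lemma hausdorff_measure_eq_0I:
  assumes "\<And>\<delta> e. 0 < \<delta> \<Longrightarrow> 0 < e \<Longrightarrow> \<exists>U. A \<subseteq> (\<Union>i. U i) \<and> (\<forall>i. bounded (U i) \<and> diameter (U i) \<le> \<delta>) \<and>
             (\<Sum>i. hausdorff_cost s (U i)) \<le> ennreal e"
  shows "hausdorff_measure s A = 0"
proof -
  have *: "hausdorff_premeasure s \<delta> A \<le> ennreal e" if "0 < \<delta>" "0 < e" for \<delta> e
    using assms[OF that] unfolding hausdorff_premeasure_def by (auto intro: INF_lower2)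
  then have "hausdorff_premeasure s \<delta> A = 0" if "0 < \<delta>" for \<delta>
  proof -
    have "hausdorff_premeasure s \<delta> A \<le> 0"
      by (rule ennreal_le_epsilon) (use *[OF that] in \<open>simp only: add_0\<close>)
    then show ?thesis by simp
  qed
  then have "hausdorff_measure s A \<le> 0"
    unfolding hausdorff_measure_def by (intro SUP_least) auto
  then show ?thesis by simp
qed

lemma hausdorff_measure_countable:
  fixes A :: "'a::metric_space set"
  assumes "countable A" "0 < s"
  shows "hausdorff_measure s A = 0"
proof (rule hausdorff_measure_eq_0I)
  fix \<delta> e :: real assume "0 < \<delta>" "0 < e"
  let ?U = "\<lambda>i. {from_nat_into A i}"
  have "A \<subseteq> (\<Union>i. ?U i)"
    using subset_range_from_nat_into[OF assms(1)] by blast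
  then show "\<exists>U. A \<subseteq> (\<Union>i. U i) \<and> (\<forall>i. bounded (U i) \<and> diameter (U i) \<le> \<delta>) \<and>
             (\<Sum>i. hausdorff_cost s (U i)) \<le> ennreal e"
    using assms(2) \<open>0 < \<delta>\<close> by (intro exI[of _ ?U]) (auto simp: hausdorff_cost_pos)
qed

text \<open>At \<open>s = 0\<close> every nonempty set costs 1, so a cover of cost below 1 has only
  empty members.\<close>

lemma hausdorff_measure_0_imp_empty:
  assumes "hausdorff_measure 0 A = 0"
  shows "A = {}"
proof -
  obtain U where U: "A \<subseteq> (\<Union>i. U i)" "(\<Sum>i. hausdorff_cost 0 (U i)) < ennreal 1"
    by (rule exists_cheap_cover[OF assms zero_less_one])
  have "U i = {}" for i
  proof (rule ccontr)
    assume "U i \<noteq> {}"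
    then have "1 = (\<Sum>j\<in>{i}. hausdorff_cost 0 (U j))"
      by (simp add: hausdorff_cost_def)
    also have "\<dots> \<le> (\<Sum>j. hausdorff_cost 0 (U j))"
      by (intro sum_le_suminf) auto
    finally show False
      using U(2) by simp
  qed
  then show ?thesis using U(1) by auto
qed

text \<open>Covering by \<open>N\<close> intervals of length \<open>1 / N\<close> costs
  \<open>N powr (1 - s)\<close>, which tends to 0.\<close>

lemma hausdorff_measure_unit_interval:
  assumes s: "1 < s" and A: "A \<subseteq> {0..1::real}"
  shows "hausdorff_measure s A = 0"
proof (rule hausdorff_measure_eq_0I)
  fix \<delta> e :: real assume "0 < \<delta>" "0 < e"
  have "((\<lambda>n. real (Suc n) powr (1 - s)) \<longlonglongrightarrow> 0)"
    using s by (intro tendsto_neg_powr filterlim_compose[OF filterlim_real_sequentially filterlim_Suc]) auto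
  then have ev1: "eventually (\<lambda>n. real (Suc n) powr (1 - s) < e) sequentially"
    using \<open>0 < e\<close> by (rule order_tendstoD)
  have ev2: "eventually (\<lambda>n. inverse (real (Suc n)) < \<delta>) sequentially"
    using LIMSEQ_inverse_real_of_nat \<open>0 < \<delta>\<close> by (rule order_tendstoD)
  obtain n where n: "real (Suc n) powr (1 - s) < e" "inverse (real (Suc n)) < \<delta>"
    using eventually_happens[OF eventually_conj[OF ev1 ev2]] by auto
  define N where "N = Suc n"
  have N: "0 < real N" by (simp add: N_def)
  define U where "U i = (if i < N then {real i / real N..(real i + 1) / real N} else {})" for i
  have dia: "diameter (U i) = (if i < N then 1 / real N else 0)" for i
  proof (cases "i < N")
    case True
    have "real i / real N \<le> (real i + 1) / real N"
      by (intro divide_right_mono) auto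
    moreover have "(real i + 1) / real N - real i / real N = 1 / real N"
      by (simp only: diff_divide_distrib[symmetric]) simp
    ultimately show ?thesis
      using True unfolding U_def by (simp only: if_True diameter_closed_interval not_less[symmetric] if_False)
  qed (simp add: U_def)
  have "A \<subseteq> (\<Union>i. U i)"
  proof
    fix x assume "x \<in> A"
    then have x: "0 \<le> x" "x \<le> 1" using A by auto
    show "x \<in> (\<Union>i. U i)"
    proof (cases "x = 1")
      \<comment> \<open>The right end point belongs to the last closed interval; the floor would
        give the index \<open>N\<close>.\<close>
      case True
      then have "x \<in> U n"
        by (simp add: U_def N_def)
      then show ?thesis by blast
    next
      case False
      then have "0 \<le> real N * x" "real N * x < real N * 1"
        using x N by (auto intro!: mult_strict_left_mono)
      moreover define j where "j = nat \<lfloor>real N * x\<rfloor>"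
      ultimately have j: "real j \<le> real N * x" "real N * x \<le> real j + 1" "j < N"
        by linarith+
      then have "x \<in> U j"
        unfolding U_def using N by (simp add: pos_divide_le_eq pos_le_divide_eq mult.commute)
      then show ?thesis by blast
    qed
  qed
  moreover have "bounded (U i) \<and> diameter (U i) \<le> \<delta>" for i
    using n(2) \<open>0 < \<delta>\<close> unfolding dia by (auto simp: U_def N_def inverse_eq_divide)
  moreover have "(\<Sum>i. hausdorff_cost s (U i)) \<le> ennreal e"
  proof -
    have "(\<Sum>i. hausdorff_cost s (U i)) = (\<Sum>i<N. hausdorff_cost s (U i))"
      by (intro suminf_finite) (auto simp: U_def hausdorff_cost_def)
    also have "\<dots> = (\<Sum>i<N. ennreal ((1 / real N) powr s))"
      using s by (intro sum.cong) (auto simp: hausdorff_cost_pos dia)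
    also have "\<dots> = ennreal (\<Sum>i<N. (1 / real N) powr s)"
      by (intro sum_ennreal) auto
    also have "(\<Sum>i<N. (1 / real N) powr s) = real N * (1 / real N) powr s"
      by simp
    also have "\<dots> = real N powr (1 - s)"
      using N by (simp add: powr_diff powr_divide)
    also have "ennreal \<dots> \<le> ennreal e"
      using n(1) by (intro ennreal_leI) (simp add: N_def)
    finally show ?thesis .
  qed
  ultimately show "\<exists>U. A \<subseteq> (\<Union>i. U i) \<and> (\<forall>i. bounded (U i) \<and> diameter (U i) \<le> \<delta>) \<and>
             (\<Sum>i. hausdorff_cost s (U i)) \<le> ennreal e"
    by blast
qed

text \<open>Countable sets are null for every positive exponent, so the exponent \<open>1/2\<close>
  already gives uncountability. This in turn rules out \<open>s = 0\<close> in the infimum.\<close>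

lemma uncountable_hausdorff_dim_1:
  assumes A: "A \<subseteq> {0..1::real}" and pos: "\<And>s. 0 < s \<Longrightarrow> s < 1 \<Longrightarrow> hausdorff_measure s A \<noteq> 0"
  shows "uncountable A \<and> hausdorff_dim A = 1"
proof
  show unc: "uncountable A"
    using hausdorff_measure_countable[of A "1/2"] pos[of "1/2"] by auto
  show "hausdorff_dim A = 1"
  proof (rule antisym)
    show "hausdorff_dim A \<le> 1"
    proof (rule ennreal_le_epsilon)
      fix e :: real assume "0 < e"
      then have "hausdorff_dim A \<le> ennreal (1 + e)"
        unfolding hausdorff_dim_def using hausdorff_measure_unit_interval[OF _ A, of "1 + e"]
        by (intro Inf_lower) (auto intro!: exI[of _ "1 + e"])
      then show "hausdorff_dim A \<le> 1 + ennreal e"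
        using \<open>0 < e\<close> by (simp add: ennreal_plus)
    qed
    show "1 \<le> hausdorff_dim A"
      unfolding hausdorff_dim_def
    proof (rule Inf_greatest)
      fix z assume "z \<in> {ennreal s |s. 0 \<le> s \<and> hausdorff_measure s A = 0}"
      then obtain s where s: "z = ennreal s" "0 \<le> s" "hausdorff_measure s A = 0"
        by auto
      have "s \<noteq> 0"
        using hausdorff_measure_0_imp_empty[of A] s unc by auto
      then have "1 \<le> s"
        using pos[of s] s by force
      then show "1 \<le> z"
        using s by (simp flip: ennreal_1 add: ennreal_leI)
    qed
  qed
qed

subsection \<open>The theorem\<close>

theorem mainTheorem1:
  fixes \<beta> \<gamma> :: real and t :: "nat \<Rightarrow> real"
  assumes "0 \<le> \<beta>" and "\<beta> < 1" and "\<gamma> > 0"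
    and "t 1 \<ge> 1"
    and "\<And>n. n \<ge> 1 \<Longrightarrow> t (n + 1) / t n \<ge> 1 + \<gamma> / real n powr \<beta>"
  shows "let A = {\<alpha> \<in> {0..1}. \<exists>\<kappa>>0. \<forall>n\<ge>1.
                   nearest_int_dist (t n * \<alpha>) > \<kappa> / (real n powr \<beta> * ln (real (n + 1)))}
         in uncountable A \<and> hausdorff_dim A = 1"
proof -
  \<comment> \<open>The ratio hypothesis can be multiplied out only once \<open>t n\<close> is known
    to be positive.\<close>
  have t_pos: "0 < t n" if "n \<ge> 1" for n
    using that
  proof (induction n rule: dec_induct)
    case base
    then show ?case using assms(4) by simp
  next
    case (step n)
    have "0 < 1 + \<gamma> / real n powr \<beta>"
      using assms(3) by (simp add: add_pos_nonneg)
    also have "\<dots> \<le> t (Suc n) / t n"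
      using assms(5)[of n] step by simp
    finally show ?case
      using step by (simp add: zero_less_divide_iff)
  qed
  interpret sparse_sequence \<beta> \<gamma> "\<lambda>n. if n = 0 then 1 else t n"
  proof
    fix n :: nat assume "n \<ge> 1"
    then show "(1 + \<gamma> / real n powr \<beta>) * (if n = 0 then 1 else t n) \<le> (if Suc n = 0 then 1 else t (Suc n))"
      using assms(5)[of n] t_pos[of n] by (simp add: pos_le_divide_eq)
  qed (use assms in auto)
  define A where "A = {\<alpha> \<in> {0..1}. \<exists>\<kappa>>0. \<forall>n\<ge>1.
                   nearest_int_dist (t n * \<alpha>) > \<kappa> / (real n powr \<beta> * ln (real (n + 1)))}"
  \<comment> \<open>A compact part of \<open>A\<close> with one fixed sequence of radii, so that
    countable open covers reduce to finite ones.\<close>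
  define X where "X = {0..1} \<inter> (\<Inter>n\<in>{1..}. {x. \<delta> n \<le> nearest_int_dist (t n * x)})"
  have "compact X"
    unfolding X_def by (intro compact_Int_closed closed_INT ballI closed_nearest_int_dist_ge) auto
  obtain \<kappa>' where \<kappa>': "\<kappa>' > 0" "\<And>n. n \<ge> 1 \<Longrightarrow> \<kappa>' / (real n powr \<beta> * ln (real (n + 1))) < \<delta> n"
    using \<delta>_lower_bound by blast
  have "X \<subseteq> A"
  proof
    fix x assume "x \<in> X"
    then have x: "x \<in> {0..1}" "\<And>n. n \<ge> 1 \<Longrightarrow> \<delta> n \<le> nearest_int_dist (t n * x)"
      by (auto simp: X_def)
    then have "\<kappa>' / (real n powr \<beta> * ln (real (n + 1))) < nearest_int_dist (t n * x)" if "n \<ge> 1" for n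
      using \<kappa>'(2)[OF that] x(2)[OF that] by linarith
    then show "x \<in> A"
      using x(1) \<kappa>'(1) unfolding A_def by blast
  qed
  have "hausdorff_measure s A \<noteq> 0" if s: "0 < s" "s < 1" for s
  proof
    assume null: "hausdorff_measure s A = 0"
    obtain \<eta> where "\<eta> > 0" and avoid: "\<And>(I :: nat set) c d. finite I \<Longrightarrow> \<forall>i\<in>I. 0 < d i \<and> d i < 1 \<Longrightarrow>
        (\<Sum>i\<in>I. d i powr s) \<le> \<eta> \<Longrightarrow> \<exists>x\<in>{0..1}. (\<forall>n\<ge>1. \<delta> n \<le> nearest_int_dist ((if n = 0 then 1 else t n) * x))
          \<and> (\<forall>i\<in>I. d i \<le> \<bar>x - c i\<bar>)"
      using not_covered[OF s(2), where 'i = nat] by metis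
    \<comment> \<open>A bound below 1 on the \<open>s\<close>-sum forces every radius below 1, as
      \<open>avoid\<close> requires.\<close>
    define e where "e = min \<eta> (1/2)"
    have e: "0 < e" "e \<le> \<eta>" "e < 1"
      using \<open>\<eta> > 0\<close> by (auto simp: e_def)
    obtain I :: "nat set" and c d where I: "finite I" "X \<subseteq> (\<Union>i\<in>I. ball (c i) (d i))"
      "\<And>i. i \<in> I \<Longrightarrow> 0 < d i" "(\<Sum>i\<in>I. d i powr s) \<le> e"
      using compact_null_finite_ball_cover[OF null s(1) \<open>compact X\<close> \<open>X \<subseteq> A\<close> e(1)] by blast
    have "d i < 1" if "i \<in> I" for i
    proof -
      have "d i powr s \<le> (\<Sum>i\<in>I. d i powr s)"
        using I(1) that by (intro member_le_sum) auto
      then have "d i powr s < 1"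
        using I(4) e(3) by linarith
      then show ?thesis
        using ge_one_powr_ge_zero[of "d i" s] s by force
    qed
    then obtain x where x: "x \<in> {0..1}" "\<forall>n\<ge>1. \<delta> n \<le> nearest_int_dist ((if n = 0 then 1 else t n) * x)"
      "\<forall>i\<in>I. d i \<le> \<bar>x - c i\<bar>"
      using avoid[of I d c] I e(2) by force
    then have "x \<in> X"
      by (auto simp: X_def)
    then show False
      using I(2) x(3) by (force simp: dist_real_def abs_minus_commute)
  qed
  then have "uncountable A \<and> hausdorff_dim A = 1"
    by (intro uncountable_hausdorff_dim_1) (auto simp: A_def)
  then show ?thesis
    unfolding A_def Let_def .
qed

end
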